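(* For every integer $\gamma\ge 2$, there exists an algorithm for the minimum spanning tree problem under explorable uncertainty with predictions that is $\min\left\{1+\frac{1}{\gamma}+\frac{5\,k_h}{|\mathrm{OPT}|},\ \gamma+1\right\}$-competitive, i.e., on every instance it queries a set $\mathrm{ALG}$ with $|\mathrm{ALG}|\le \min\left\{1+\frac{1}{\gamma}+\frac{5\,k_h}{|\mathrm{OPT}|},\ \gamma+1\right\}\cdot|\mathrm{OPT}|$.
   Context: MST problem under explorable uncertainty with predictions: an instance is a connected (multi)graph $G=(V,E)$. Each edge $e$ has an unknown true weight $w_e\in\mathbb{R}_+$ and a known uncertainty interval $I_e$, either an open interval $(L_e,U_e)$ containing $w_e$ or the trivial interval $\{w_e\}$ (then $L_e=U_e=w_e$). Querying an edge reveals $w_e$. A set $Q\subseteq E$ is a feasible query set if there is a spanning tree $T$ that is a minimum spanning tree for every weight assignment that equals $w_e$ for $e\in Q$ and takes arbitrary values in $I_e$ for $e\notin Q$. $\mathrm{OPT}$ is a feasible query set of minimum cardinality. An algorithm queries edges adaptively until its set $\mathrm{ALG}$ of queried edges is feasible; it is given a prediction $\hat w_e\in I_e$ for every edge. Hop distance: for distinct edges $e,e'$, let $k_{e'}(e)=0$ if $w_e$ and $\hat w_e$ lie in the same one of the three regions $(-\infty,L_{e'}]$, $(L_{e'},U_{e'})$, $[U_{e'},\infty)$, and $k_{e'}(e)=1$ otherwise. The hop distance is $k_h=\sum_{e\in E}\sum_{e'\in E\setminus\{e\}}k_{e'}(e)$. *)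

theory Defs
  imports Complex_Main
begin

section \<open>Undirected multigraphs\<close>

text \<open>
  Graph_Theory is about digraphs (its forests only exclude directed cycles), hence the undirected
  notions below. An edge is a name together with its set of end vertices; parallel edges are
  distinct names with the same ends, and a loop is an edge with a single end.
\<close>

record ('v, 'e) mgraph =
  verts :: "'v set"
  edges :: "'e set"
  ends :: "'e \<Rightarrow> 'v set"

definition multigraph :: "('v, 'e, 'z) mgraph_scheme \<Rightarrow> bool" where
  "multigraph G \<longleftrightarrow>
     finite (verts G) \<and> finite (edges G) \<and>
     (\<forall>e\<in>edges G. ends G e \<subseteq> verts G \<and> card (ends G e) \<in> {1, 2})"

definition adjacency :: "('v, 'e, 'z) mgraph_scheme \<Rightarrow> 'e set \<Rightarrow> ('v \<times> 'v) set" where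
  "adjacency G F = {(u, v). \<exists>e\<in>F. ends G e = {u, v}}"

definition connected_by :: "('v, 'e, 'z) mgraph_scheme \<Rightarrow> 'e set \<Rightarrow> bool" where
  "connected_by G F \<longleftrightarrow>
     verts G \<noteq> {} \<and> (\<forall>u\<in>verts G. \<forall>v\<in>verts G. (u, v) \<in> (adjacency G F)\<^sup>*)"

text \<open>
  The cycle through vertices \<open>vs\<close> and edges \<open>es\<close>, where \<open>es ! i\<close> joins \<open>vs ! i\<close> to its cyclic
  successor. Length 1 is a loop, length 2 a pair of parallel edges.
\<close>

definition is_cycle :: "('v, 'e, 'z) mgraph_scheme \<Rightarrow> 'v list \<Rightarrow> 'e list \<Rightarrow> bool" where
  "is_cycle G vs es \<longleftrightarrow>
     es \<noteq> [] \<and> length vs = length es \<and> distinct vs \<and> distinct es \<and>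
     (\<forall>i<length es. ends G (es ! i) = {vs ! i, vs ! (Suc i mod length es)})"

definition acyclic_edges :: "('v, 'e, 'z) mgraph_scheme \<Rightarrow> 'e set \<Rightarrow> bool" where
  "acyclic_edges G F \<longleftrightarrow> \<not> (\<exists>vs es. set es \<subseteq> F \<and> is_cycle G vs es)"

definition spanning_tree :: "('v, 'e, 'z) mgraph_scheme \<Rightarrow> 'e set \<Rightarrow> bool" where
  "spanning_tree G T \<longleftrightarrow> T \<subseteq> edges G \<and> connected_by G T \<and> acyclic_edges G T"

definition is_mst :: "('v, 'e, 'z) mgraph_scheme \<Rightarrow> ('e \<Rightarrow> real) \<Rightarrow> 'e set \<Rightarrow> bool" where
  "is_mst G w T \<longleftrightarrow>
     spanning_tree G T \<and> (\<forall>T'. spanning_tree G T' \<longrightarrow> sum w T \<le> sum w T')"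


section \<open>Explorable uncertainty with predictions\<close>

text \<open>
  The record holds exactly what is known in advance. The true weights are a separate function
  \<open>w\<close>, which an algorithm can access only through queries.
\<close>

record ('v, 'e) mst_input = "('v, 'e) mgraph" +
  lower :: "'e \<Rightarrow> real"
  upper :: "'e \<Rightarrow> real"
  pred :: "'e \<Rightarrow> real"

definition interval :: "('v, 'e) mst_input \<Rightarrow> 'e \<Rightarrow> real set" where
  "interval G e = (if lower G e = upper G e then {lower G e} else {lower G e<..<upper G e})"

definition mst_instance :: "('v, 'e) mst_input \<Rightarrow> ('e \<Rightarrow> real) \<Rightarrow> bool" where
  "mst_instance G w \<longleftrightarrow>
     multigraph G \<and> connected_by G (edges G) \<and>
     (\<forall>e\<in>edges G. 0 \<le> w e \<and> w e \<in> interval G e \<and> pred G e \<in> interval G e)"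

definition feasible :: "('v, 'e) mst_input \<Rightarrow> ('e \<Rightarrow> real) \<Rightarrow> 'e set \<Rightarrow> bool" where
  "feasible G w Q \<longleftrightarrow>
     Q \<subseteq> edges G \<and>
     (\<exists>T. \<forall>w'. (\<forall>e\<in>Q. w' e = w e) \<and> (\<forall>e\<in>edges G - Q. w' e \<in> interval G e) \<longrightarrow> is_mst G w' T)"

definition optimal :: "('v, 'e) mst_input \<Rightarrow> ('e \<Rightarrow> real) \<Rightarrow> 'e set \<Rightarrow> bool" where
  "optimal G w Q \<longleftrightarrow> feasible G w Q \<and> (\<forall>Q'. feasible G w Q' \<longrightarrow> card Q \<le> card Q')"

text \<open>
  The three regions are taken literally: for a trivial interval the two outer ones share the
  point \<open>lower G e' = upper G e'\<close>.
\<close>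

definition hop :: "('v, 'e) mst_input \<Rightarrow> ('e \<Rightarrow> real) \<Rightarrow> 'e \<Rightarrow> 'e \<Rightarrow> nat" where
  "hop G w e' e =
     (if \<exists>R\<in>{{..lower G e'}, {lower G e'<..<upper G e'}, {upper G e'..}}. w e \<in> R \<and> pred G e \<in> R
      then 0 else 1)"

definition hop_distance :: "('v, 'e) mst_input \<Rightarrow> ('e \<Rightarrow> real) \<Rightarrow> nat" where
  "hop_distance G w = (\<Sum>e\<in>edges G. \<Sum>e'\<in>edges G - {e}. hop G w e' e)"


section \<open>Adaptive query algorithms\<close>

text \<open>
  A deterministic algorithm sees the known input and the answers so far, in query order, and
  names the next edge to query or stops (\<open>None\<close>).
\<close>

type_synonym ('v, 'e) algorithm = "('v, 'e) mst_input \<Rightarrow> ('e \<times> real) list \<Rightarrow> 'e option"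

inductive transcript ::
    "('v, 'e) algorithm \<Rightarrow> ('v, 'e) mst_input \<Rightarrow> ('e \<Rightarrow> real) \<Rightarrow> ('e \<times> real) list \<Rightarrow> bool"
  for A :: "('v, 'e) algorithm" and G :: "('v, 'e) mst_input" and w :: "'e \<Rightarrow> real"
where
  start: "transcript A G w []"
| query: "transcript A G w h \<Longrightarrow> A G h = Some e \<Longrightarrow> transcript A G w (h @ [(e, w e)])"

text \<open>The run of \<open>A\<close> terminates and \<open>Q\<close> is the set of edges it has queried by then.\<close>

definition queries :: "('v, 'e) algorithm \<Rightarrow> ('v, 'e) mst_input \<Rightarrow> ('e \<Rightarrow> real) \<Rightarrow> 'e set \<Rightarrow> bool" where
  "queries A G w Q \<longleftrightarrow> (\<exists>h. transcript A G w h \<and> A G h = None \<and> Q = fst ` set h)"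

end

(*
  A query set is feasible iff every unqueried edge with a nontrivial interval (L, U) is settled: its
  ends are connected by edges whose upper limit is at most L, or not connected by the other edges with
  lower limit below U. This test compares weights only with limits of unqueried edges, so for a query
  set that contains the set B of edges at which a hop error occurs (card B <= k_h) feasibility for the
  predicted and for the true weights coincide. Hence, for a smallest set F that is feasible for the
  predictions, D = F Un B is feasible and has at most |OPT| + 2 |B| edges.

  In an infeasible state there is always a witness set, at most two unqueried edges one of which lies in
  every feasible set. The algorithm alternates between gamma - 1 edges of F (or all that are left) and a
  witness set. Each round has at most gamma + 1 queries, one of them in OPT, which gives the robust
  bound. At most one query per round lies outside D, and a round has at least gamma queries in D as long
  as F lasts, and after that one in D - F, a subset of B; this gives
  gamma |ALG| <= (gamma + 1) |D| + (gamma - 1) |B| <= (gamma + 1) |OPT| + 5 gamma k_h.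
*)

theory Submission
  imports Defs
begin

section \<open>Closure operators with exchange\<close>

definition independent :: "('e set \<Rightarrow> 'e set) \<Rightarrow> 'e set \<Rightarrow> bool" where
  "independent cl F \<longleftrightarrow> (\<forall>f\<in>F. f \<notin> cl (F - {f}))"

text \<open>
  A nontrivial edge is settled if it is surely the largest on a cycle, and can be dropped, or
  surely the smallest across a cut, and can be chosen.
\<close>
definition unsettled ::
    "('e set \<Rightarrow> 'e set) \<Rightarrow> ('e \<Rightarrow> real) \<Rightarrow> ('e \<Rightarrow> real) \<Rightarrow> 'e set \<Rightarrow> 'e \<Rightarrow> bool" where
  "unsettled cl l u M e \<longleftrightarrow>
     e \<in> M \<and> l e < u e \<and> e \<notin> cl {f \<in> M. u f \<le> l e} \<and> e \<in> cl {f \<in> M. f \<noteq> e \<and> l f < u e}"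

text \<open>The closure axioms of a finite matroid. For graphs, \<open>cl F\<close> consists of the
  edges whose ends \<open>F\<close> connects, and bases are spanning trees; certain optimality is
  analysed at this level, without paths and cycles.\<close>

locale exchange_closure =
  fixes E :: "'e set" and cl :: "'e set \<Rightarrow> 'e set"
  assumes finite_ground: "finite E"
    and cl_subset: "cl F \<subseteq> E"
    and cl_extensive: "F \<subseteq> E \<Longrightarrow> F \<subseteq> cl F"
    and cl_mono: "F \<subseteq> F' \<Longrightarrow> cl F \<subseteq> cl F'"
    and cl_idem: "F \<subseteq> E \<Longrightarrow> cl (cl F) \<subseteq> cl F"
    and exchange: "F \<subseteq> E \<Longrightarrow> h \<in> E \<Longrightarrow> e \<in> cl (insert h F) \<Longrightarrow> e \<notin> cl F \<Longrightarrow> h \<in> cl (insert e F)"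
begin

definition basis :: "'e set \<Rightarrow> bool" where
  "basis T \<longleftrightarrow> T \<subseteq> E \<and> E \<subseteq> cl T \<and> independent cl T"

lemma cl_trans: "e \<in> cl X" if "e \<in> cl Y" "Y \<subseteq> cl X" "X \<subseteq> E"
  using that cl_mono[of Y "cl X"] cl_idem[of X] by blast

lemma cl_insert_absorb: "cl (insert e X) \<subseteq> cl X" if "e \<in> cl X" "X \<subseteq> E"
proof
  fix x assume "x \<in> cl (insert e X)"
  moreover have "insert e X \<subseteq> cl X" using that cl_extensive by blast
  ultimately show "x \<in> cl X" using that cl_trans by blast
qed

text \<open>Each \<open>h\<close> in \<open>Z\<close> that lies in \<open>Y\<close> is a coloop of
  \<open>Y\<close> with \<open>e\<close> added (in a graph, a bridge), so no circuit through
  \<open>e\<close> uses it. If deleting \<open>h\<close> lost \<open>e\<close>, exchange would put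
  \<open>h\<close> into the closure of \<open>e\<close> and the rest.\<close>

lemma cl_removal:
  assumes "e \<in> cl Y" "Y \<subseteq> E" "finite Z" "\<And>h. h \<in> Z \<Longrightarrow> h \<notin> cl (insert e (Y - {h}))"
  shows "e \<in> cl (Y - Z)"
  using assms(3,4)
proof (induction Z)
  case empty
  then show ?case using assms(1) by simp
next
  case (insert h Z)
  have IH: "e \<in> cl (Y - Z)" using insert by blast
  show ?case
  proof (rule ccontr)
    assume n: "e \<notin> cl (Y - insert h Z)"
    have "h \<in> Y - Z"
    proof (rule ccontr)
      assume "h \<notin> Y - Z"
      then have "Y - insert h Z = Y - Z" by blast
      then show False using n IH by simp
    qed
    then have eq: "insert h (Y - insert h Z) = Y - Z" "h \<in> E" using assms(2) by auto
    have "h \<in> cl (insert e (Y - insert h Z))"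
      using exchange[of "Y - insert h Z" h e] eq IH n assms(2) by auto
    moreover have "insert e (Y - insert h Z) \<subseteq> insert e (Y - {h})" by auto
    ultimately have "h \<in> cl (insert e (Y - {h}))" using cl_mono by blast
    then show False using insert.prems by blast
  qed
qed

lemma basis_exchange:
  assumes "basis T" "f \<in> T" "e \<in> E" "e \<notin> cl (T - {f})"
  shows "basis (insert e (T - {f}))"
proof -
  have TE: "T \<subseteq> E" and ET: "E \<subseteq> cl T" and ind: "\<And>g. g \<in> T \<Longrightarrow> g \<notin> cl (T - {g})"
    using assms(1) by (auto simp: basis_def independent_def)
  let ?S = "T - {f}"
  have SE: "?S \<subseteq> E" using TE by blast
  have Tf: "insert f ?S = T" using assms(2) by blast
  have fcl: "f \<in> cl (insert e ?S)"
    using exchange[OF SE, of f e] assms Tf ET TE by auto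
  have sub: "insert e ?S \<subseteq> E" using SE assms(3) by blast
  have "T \<subseteq> cl (insert e ?S)" using fcl cl_extensive[OF sub] by blast
  then have span: "E \<subseteq> cl (insert e ?S)" using cl_trans[OF _ _ sub] ET by blast
  have "g \<notin> cl (insert e ?S - {g})" if g: "g \<in> insert e ?S" for g
  proof (cases "g = e")
    case True
    have "cl (insert e ?S - {e}) \<subseteq> cl ?S" by (rule cl_mono) auto
    then show ?thesis using assms(4) True by blast
  next
    case False
    then have gT: "g \<in> T" "g \<noteq> f" using g by auto
    have eq: "insert e ?S - {g} = insert e (?S - {g})" using False by auto
    have ng: "g \<notin> cl (?S - {g})"
      using ind[OF gT(1)] cl_mono[of "?S - {g}" "T - {g}"] by blast
    show ?thesis
    proof
      assume "g \<in> cl (insert e ?S - {g})"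
      then have "e \<in> cl (insert g (?S - {g}))"
        using exchange[of "?S - {g}" e g] ng SE assms(3) eq by auto
      moreover have "insert g (?S - {g}) = ?S" using gT by auto
      ultimately show False using assms(4) by simp
    qed
  qed
  then show ?thesis using sub span by (auto simp: basis_def independent_def)
qed

lemma basis_exists: "\<exists>T. basis T"
proof -
  let ?P = "\<lambda>T. T \<subseteq> E \<and> E \<subseteq> cl T"
  have "?P E" using cl_extensive by blast
  then obtain T where T: "?P T" and min: "\<And>T'. ?P T' \<Longrightarrow> card T \<le> card T'"
    using ex_has_least_nat[of ?P E card] by blast
  have "f \<notin> cl (T - {f})" if f: "f \<in> T" for f
  proof
    assume "f \<in> cl (T - {f})"
    moreover have sub: "T - {f} \<subseteq> E" using T by blast
    ultimately have "T \<subseteq> cl (T - {f})" using cl_extensive[OF sub] by blast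
    then have "?P (T - {f})" using T sub cl_trans[OF _ _ sub] by blast
    then have "card T \<le> card (T - {f})" using min by blast
    moreover have "card (T - {f}) < card T"
      using f T finite_ground by (meson card_Diff1_less finite_subset)
    ultimately show False by simp
  qed
  then show ?thesis using T by (auto simp: basis_def independent_def)
qed

section \<open>Bases of minimum weight\<close>

lemma sum_basis_exchange:
  fixes w :: "'e \<Rightarrow> real"
  assumes "basis T" "f \<in> T" "e \<in> E" "e \<notin> cl (T - {f})" "e \<noteq> f"
  shows "sum w (insert e (T - {f})) = sum w T - w f + w e"
proof -
  have fin: "finite T" using assms(1) finite_ground finite_subset by (auto simp: basis_def)
  have "e \<notin> T - {f}"
    using assms(1,4) cl_extensive[of "T - {f}"] by (auto simp: basis_def)
  then show ?thesis using fin assms(2) by (simp add: sum_diff1)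
qed

definition min_basis :: "('e \<Rightarrow> real) \<Rightarrow> 'e set \<Rightarrow> bool" where
  "min_basis w T \<longleftrightarrow> basis T \<and> (\<forall>T'. basis T' \<longrightarrow> sum w T \<le> sum w T')"

lemma min_basis_exchange_le:
  assumes "min_basis w T" "f \<in> T" "e \<in> E" "e \<notin> cl (T - {f})"
  shows "w f \<le> w e"
proof (cases "e = f")
  case False
  have "sum w T \<le> sum w (insert e (T - {f}))"
    using assms basis_exchange by (auto simp: min_basis_def)
  then show ?thesis
    using sum_basis_exchange[of T f e w] assms False by (auto simp: min_basis_def)
qed simp

text \<open>The \<open>f\<close> in \<open>T\<close> with \<open>e \<notin> cl (T - {f})\<close> are
  those that \<open>e\<close> can replace, in a tree the path between the ends of \<open>e\<close>;
  they alone span \<open>e\<close>. The others are discarded by \<open>cl_removal\<close>, since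
  \<open>e\<close> adds nothing to the closure of \<open>T - {h}\<close>.\<close>

lemma basis_cl_restrict:
  assumes "basis T" "e \<in> E" "\<And>f. f \<in> T \<Longrightarrow> e \<notin> cl (T - {f}) \<Longrightarrow> P f"
  shows "e \<in> cl {f \<in> T. P f}"
proof -
  have TE: "T \<subseteq> E" and ET: "E \<subseteq> cl T" and ind: "\<And>g. g \<in> T \<Longrightarrow> g \<notin> cl (T - {g})"
    using assms(1) by (auto simp: basis_def independent_def)
  let ?Z = "{f \<in> T. e \<in> cl (T - {f})}"
  have "h \<notin> cl (insert e (T - {h}))" if "h \<in> ?Z" for h
    using that ind[of h] cl_insert_absorb[of e "T - {h}"] TE by blast
  then have "e \<in> cl (T - ?Z)"
    using cl_removal[of e T ?Z] ET assms(2) TE finite_ground finite_subset by fastforce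
  moreover have "T - ?Z \<subseteq> {f \<in> T. P f}" using assms(3) by auto
  ultimately show ?thesis using cl_mono by blast
qed

text \<open>Induction on the number of elements of a rival \<open>T'\<close> outside
  \<open>T\<close>: replacing one of them by an element of \<open>T\<close> that is no heavier
  brings \<open>T'\<close> closer to \<open>T\<close> without raising its weight.\<close>

lemma min_basisI:
  assumes "basis T" "\<And>e. e \<in> E - T \<Longrightarrow> e \<in> cl {f \<in> T. w f \<le> w e}"
  shows "min_basis w T"
proof -
  have fin: "finite T" and TE: "T \<subseteq> E" and ind: "\<And>g. g \<in> T \<Longrightarrow> g \<notin> cl (T - {g})"
    using assms(1) finite_ground finite_subset by (auto simp: basis_def independent_def)
  have "sum w T \<le> sum w T'" if "basis T'" for T'
    using that
  proof (induction "card (T' - T)" arbitrary: T' rule: less_induct)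
    case less
    have T'E: "T' \<subseteq> E" and ET': "E \<subseteq> cl T'" and ind': "\<And>g. g \<in> T' \<Longrightarrow> g \<notin> cl (T' - {g})"
      using less.prems by (auto simp: basis_def independent_def)
    have fin': "finite T'" using T'E finite_ground finite_subset by blast
    show ?case
    proof (cases "T' \<subseteq> T")
      case True
      have "T \<subseteq> T'"
      proof (rule ccontr)
        assume "\<not> T \<subseteq> T'"
        then obtain g where g: "g \<in> T" "g \<notin> T'" by blast
        then have "cl T' \<subseteq> cl (T - {g})" using True by (intro cl_mono) auto
        then show False using g ET' TE ind by blast
      qed
      then show ?thesis using True by simp
    next
      case False
      then obtain e where e: "e \<in> T'" "e \<notin> T" by blast
      \<comment> \<open>The elements of \<open>T\<close> no heavier than \<open>e\<close> span
        \<open>e\<close>, so they cannot all lie in the closure of \<open>T' - {e}\<close>, which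
        misses \<open>e\<close>.\<close>
      have "\<exists>f\<in>T. w f \<le> w e \<and> f \<notin> cl (T' - {e})"
      proof (rule ccontr)
        assume "\<not> ?thesis"
        then have "{f \<in> T. w f \<le> w e} \<subseteq> cl (T' - {e})" by blast
        then have "e \<in> cl (T' - {e})"
          using cl_trans assms(2) e T'E by (meson Diff_iff Diff_subset order_trans subsetD)
        then show False using ind' e by blast
      qed
      then obtain f where f: "f \<in> T" "w f \<le> w e" "f \<notin> cl (T' - {e})" by blast
      let ?T = "insert f (T' - {e})"
      have fe: "f \<noteq> e" using f e by blast
      have "f \<notin> T'" using f cl_extensive[of "T' - {e}"] T'E fe by blast
      have B: "basis ?T" using basis_exchange[OF less.prems e(1)] f TE by blast
      have "?T - T = (T' - T) - {e}" using f by auto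
      then have "card (?T - T) < card (T' - T)"
        using e fin' by (metis Diff_iff card_Diff1_less finite_Diff)
      then have "sum w T \<le> sum w ?T" using less.hyps B by blast
      also have "\<dots> = sum w T' - w e + w f"
        using sum_basis_exchange[OF less.prems e(1), of f w] f TE fe by blast
      finally show ?thesis using f by simp
    qed
  qed
  then show ?thesis using assms(1) by (auto simp: min_basis_def)
qed

lemma min_basis_exists: "\<exists>T. min_basis w T"
proof -
  have fin: "finite {T. basis T}"
    by (rule finite_subset[of _ "Pow E"]) (auto simp: basis_def finite_ground)
  have ne: "{T. basis T} \<noteq> {}" using basis_exists by blast
  obtain T where "is_arg_min (sum w) (\<lambda>T. T \<in> {T. basis T}) T"
    using ex_is_arg_min_if_finite[OF fin ne] by blast
  then show ?thesis unfolding is_arg_min_def min_basis_def by (metis linorder_not_less mem_Collect_eq)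
qed

end

section \<open>Interval weights\<close>

definition realizes :: "'e set \<Rightarrow> ('e \<Rightarrow> real) \<Rightarrow> ('e \<Rightarrow> real) \<Rightarrow> ('e \<Rightarrow> real) \<Rightarrow> bool" where
  "realizes E l u w \<longleftrightarrow> (\<forall>e\<in>E. l e = u e \<and> w e = l e \<or> l e < w e \<and> w e < u e)"

lemma realizes_bounds:
  assumes "realizes E l u w" "e \<in> E"
  shows "l e \<le> w e" "w e \<le> u e"
  using assms by (force simp: realizes_def)+

context exchange_closure
begin

lemma exchange_of_cl:
  assumes "e \<in> cl X" "X \<subseteq> E" "e \<notin> cl S" "S \<subseteq> E"
  shows "\<exists>g\<in>X. g \<notin> cl S"
  using assms cl_trans by (meson subsetI)

text \<open>Nontrivial intervals are open, so \<open>l e < u f\<close> leaves room for a value of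
  \<open>f\<close> above \<open>l e\<close> and then for one of \<open>e\<close> below it; trivial
  intervals already satisfy this.\<close>

lemma realization_exists:
  fixes l u :: "'e \<Rightarrow> real"
  assumes "realizes E l u w" "e \<in> E" "f \<in> E" "e \<noteq> f" "l e < u f"
  shows "\<exists>w'. realizes E l u w' \<and> w' e < w' f"
proof -
  have le: "\<And>g. g \<in> E \<Longrightarrow> l g \<le> u g" using assms(1) by (force simp: realizes_def)
  obtain y where y: "l f = u f \<and> y = l f \<or> l f < y \<and> y < u f" "l e < y"
  proof (cases "l f = u f")
    case True
    then show ?thesis using that[of "l f"] assms(5) by simp
  next
    case False
    then have "max (l f) (l e) < u f" using le[OF assms(3)] assms(5) by simp
    then obtain y where "max (l f) (l e) < y" "y < u f" using dense by blast
    then show ?thesis using that[of y] by simp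
  qed
  obtain x where x: "l e = u e \<and> x = l e \<or> l e < x \<and> x < u e" "x < y"
  proof (cases "l e = u e")
    case True
    then show ?thesis using that[of "l e"] y by simp
  next
    case False
    then have "l e < min (u e) y" using le[OF assms(2)] y by simp
    then obtain x where "l e < x" "x < min (u e) y" using dense by blast
    then show ?thesis using that[of x] by simp
  qed
  have "realizes E l u (w(e := x, f := y))"
    using assms x y by (auto simp: realizes_def)
  then show ?thesis using x assms(4) by (intro exI[of _ "w(e := x, f := y)"]) simp
qed

text \<open>If \<open>T\<close> stays optimal for all realizations, every exchange of
  \<open>f\<close> for \<open>h\<close> has \<open>u f \<le> l h\<close>. For \<open>e\<close> in
  \<open>T\<close> this contradicts that edges with lower limit below \<open>u e\<close> span
  \<open>e\<close>; for \<open>e\<close> outside, the edges it can replace have upper limit at most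
  \<open>l e\<close> and span it.\<close>

lemma settled_if_min_basis:
  assumes "realizes E l u w" "\<And>w'. realizes E l u w' \<Longrightarrow> min_basis w' T"
  shows "\<not> unsettled cl l u E e"
proof
  assume un: "unsettled cl l u E e"
  have T: "basis T" using assms by (auto simp: min_basis_def)
  then have TE: "T \<subseteq> E" and ind: "\<And>g. g \<in> T \<Longrightarrow> g \<notin> cl (T - {g})"
    by (auto simp: basis_def independent_def)
  have ex: "u f \<le> l h" if fh: "f \<in> T" "h \<in> E" "h \<notin> cl (T - {f})" "h \<noteq> f" for f h
  proof (rule ccontr)
    assume "\<not> u f \<le> l h"
    then obtain w' where w': "realizes E l u w'" "w' h < w' f"
      using realization_exists[OF assms(1) fh(2) _ fh(4)] fh(1) TE
      by (meson not_le subsetD)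
    show False using min_basis_exchange_le[OF assms(2)[OF w'(1)] fh(1-3)] w'(2) by simp
  qed
  have eE: "e \<in> E" and lu: "l e < u e" and a: "e \<notin> cl {f \<in> E. u f \<le> l e}"
    and b: "e \<in> cl {f \<in> E. f \<noteq> e \<and> l f < u e}"
    using un by (auto simp: unsettled_def)
  show False
  proof (cases "e \<in> T")
    case True
    then have "\<exists>g\<in>{f \<in> E. f \<noteq> e \<and> l f < u e}. g \<notin> cl (T - {e})"
      by (intro exchange_of_cl[OF b] ind) (use TE in auto)
    then obtain g where "g \<in> E" "g \<noteq> e" "l g < u e" "g \<notin> cl (T - {e})" by blast
    then show False using ex[OF True, of g] by simp
  next
    case False
    have "e \<in> cl {f \<in> T. u f \<le> l e}"
    proof (rule basis_cl_restrict[OF T eE])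
      fix f assume "f \<in> T" "e \<notin> cl (T - {f})"
      then show "u f \<le> l e" using ex[of f e] eE False by metis
    qed
    moreover have "{f \<in> T. u f \<le> l e} \<subseteq> {f \<in> E. u f \<le> l e}" using TE by auto
    ultimately show False using a cl_mono by blast
  qed
qed

lemma min_basis_cl:
  assumes "min_basis w T" "e \<in> E"
  shows "e \<in> cl {f \<in> T. w f \<le> w e}"
proof (rule basis_cl_restrict)
  show "basis T" using assms by (simp add: min_basis_def)
qed (use assms min_basis_exchange_le in blast)+

text \<open>
  First an edge \<open>g\<close> of known weight: if it could replace \<open>f\<close>, its cycle would consist of edges
  with lower limits below \<open>u f\<close>. The general case reduces to this one by choosing a violating edge with
  minimal lower limit.
\<close>
lemma settled_exchange_le:
  assumes w: "realizes E l u w" and T: "min_basis w T" and settled: "\<And>e. \<not> unsettled cl l u E e"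
    and f: "f \<in> T"
  shows "e \<in> E \<Longrightarrow> e \<notin> cl (T - {f}) \<Longrightarrow> e \<noteq> f \<Longrightarrow> u f \<le> l e"
proof (rule ccontr)
  assume "e \<in> E" "e \<notin> cl (T - {f})" "e \<noteq> f" "\<not> u f \<le> l e"
  define C where "C = {e \<in> E. e \<notin> cl (T - {f}) \<and> e \<noteq> f \<and> l e < u f}"
  have "C \<noteq> {}" "finite C"
    using \<open>e \<in> E\<close> \<open>e \<notin> _\<close> \<open>e \<noteq> f\<close> \<open>\<not> u f \<le> l e\<close> finite_ground by (auto simp: C_def)
  then obtain e where eC: "e \<in> C" and min: "\<And>g. g \<in> C \<Longrightarrow> l e \<le> l g"
    using ex_is_arg_min_if_finite[of C l] by (auto simp: is_arg_min_def not_less)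
  have B: "basis T" using T by (simp add: min_basis_def)
  then have TE: "T \<subseteq> E" and ind: "\<And>g. g \<in> T \<Longrightarrow> g \<notin> cl (T - {g})"
    by (auto simp: basis_def independent_def)
  have wl: "\<And>g. g \<in> E \<Longrightarrow> l g = u g \<and> w g = l g \<or> l g < w g \<and> w g < u g"
    using w by (auto simp: realizes_def)
  have eT: "g \<notin> T" if "g \<in> C" for g
    using that cl_extensive[of "T - {f}"] TE by (auto simp: C_def)
  have trivial_case: "l g \<noteq> u g" if g: "g \<in> C" for g
  proof
    assume triv: "l g = u g"
    have gE: "g \<in> E" and gn: "g \<notin> cl (T - {f})" "l g < u f"
      using g by (auto simp: C_def)
    have wg: "w g = l g" using wl[OF gE] triv by auto
    have "w f \<le> w g" using min_basis_exchange_le[OF T f gE gn(1)] .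
    moreover have "f \<in> E" using f TE by blast
    ultimately have nf: "l f < w f" "w f < u f" using wl[of f] wg gn by auto
    \<comment> \<open>Any set that spans \<open>f\<close> contains an element that can replace
      \<open>f\<close>, of weight at least \<open>w f > l f\<close>.\<close>
    have nA: "f \<notin> cl {h \<in> E. u h \<le> l f}"
    proof
      assume "f \<in> cl {h \<in> E. u h \<le> l f}"
      then obtain h where h: "h \<in> E" "u h \<le> l f" "h \<notin> cl (T - {f})"
        using exchange_of_cl[OF _ _ ind[OF f], of "{h \<in> E. u h \<le> l f}"] TE by auto
      then have "w f \<le> w h" using min_basis_exchange_le[OF T f] by blast
      then show False using h wl[of h] nf by auto
    qed
    \<comment> \<open>\<open>g\<close> depends on tree elements of weight at most
      \<open>w g = l g < u f\<close>, and \<open>f\<close> is needed among them. Swapping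
      \<open>f\<close> and \<open>g\<close> shows that others with lower limit below
      \<open>u f\<close> span \<open>f\<close>, so \<open>f\<close> is unsettled.\<close>
    let ?Y = "{h \<in> T. w h \<le> w g}"
    have "g \<in> cl ?Y" using min_basis_cl[OF T gE] .
    moreover have "g \<notin> cl (?Y - {f})" using gn cl_mono[of "?Y - {f}" "T - {f}"] by blast
    moreover have "insert f (?Y - {f}) = ?Y" using f \<open>w f \<le> w g\<close> by auto
    ultimately have "f \<in> cl (insert g (?Y - {f}))"
      using exchange[of "?Y - {f}" f g] f TE by auto
    moreover have "insert g (?Y - {f}) \<subseteq> {h \<in> E. h \<noteq> f \<and> l h < u f}"
      using wl wg gn gE TE g by (force simp: C_def)
    ultimately have "f \<in> cl {h \<in> E. h \<noteq> f \<and> l h < u f}" using cl_mono by blast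
    then have "unsettled cl l u E f" using nA nf f TE by (auto simp: unsettled_def)
    then show False using settled by blast
  qed
  have eE: "e \<in> E" using eC by (auto simp: C_def)
  have ne: "l e < w e" "w e < u e" using wl[OF eE] trivial_case[OF eC] by auto
  have "{h \<in> T. w h \<le> w e} \<subseteq> {h \<in> E. h \<noteq> e \<and> l h < u e}"
    using wl ne TE eT[OF eC] by force
  then have "e \<in> cl {h \<in> E. h \<noteq> e \<and> l h < u e}" using min_basis_cl[OF T eE] cl_mono by blast
  then have "e \<in> cl {h \<in> E. u h \<le> l e}" using settled[of e] ne eE by (auto simp: unsettled_def)
  moreover have "e \<notin> cl (T - {f})" using eC by (simp add: C_def)
  \<comment> \<open>This \<open>g\<close> violates the claim as well, and
    \<open>l g \<le> u g \<le> l e\<close>; minimality of \<open>l e\<close> would force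
    \<open>g\<close> to be trivial.\<close>
  ultimately obtain g where g: "g \<in> E" "u g \<le> l e" "g \<notin> cl (T - {f})"
    using exchange_of_cl[of e "{h \<in> E. u h \<le> l e}" "T - {f}"] TE by auto
  have "l g \<le> u g" using wl[OF g(1)] by auto
  moreover have "g \<noteq> f" "l e < u f" using g eC by (auto simp: C_def)
  ultimately have gC: "g \<in> C" using g by (auto simp: C_def)
  then have "l g < u g" using trivial_case \<open>l g \<le> u g\<close> by force
  then show False using min[OF gC] g by simp
qed

text \<open>An optimum for one realization serves all others, since by
  \<open>settled_exchange_le\<close> the limits alone decide the order of weights in each possible
  exchange.\<close>

lemma min_basis_if_settled:
  assumes "realizes E l u w" "min_basis w T" "\<And>e. \<not> unsettled cl l u E e" "realizes E l u w'"
  shows "min_basis w' T"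
proof (rule min_basisI)
  show B: "basis T" using assms by (simp add: min_basis_def)
  fix e assume e: "e \<in> E - T"
  have le: "w' f \<le> w' e" if "f \<in> T" "e \<notin> cl (T - {f})" for f
  proof -
    have "u f \<le> l e" using settled_exchange_le[OF assms(1-3) that(1)] e that by blast
    moreover have "f \<in> E" using B that by (auto simp: basis_def)
    ultimately show ?thesis
      using realizes_bounds[OF assms(4), of f] realizes_bounds[OF assms(4), of e] e by simp
  qed
  show "e \<in> cl {f \<in> T. w' f \<le> w' e}"
    by (rule basis_cl_restrict[OF B]) (use e le in auto)
qed


section \<open>Witness sets\<close>

text \<open>Models further queries. Querying a trivial interval falls under the first alternative,
  so \<open>l' e \<noteq> l e\<close> singles out the nontrivial edges among the new
  queries.\<close>

definition refines :: "('e \<Rightarrow> real) \<Rightarrow> ('e \<Rightarrow> real) \<Rightarrow> ('e \<Rightarrow> real) \<Rightarrow> ('e \<Rightarrow> real) \<Rightarrow> bool" where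
  "refines l u l' u' \<longleftrightarrow>
     (\<forall>e\<in>E. l' e = l e \<and> u' e = u e \<or> l e < l' e \<and> l' e = u' e \<and> u' e < u e)"

lemma settled_refines:
  assumes "refines l u l' u'" "\<not> unsettled cl l u E e"
  shows "\<not> unsettled cl l' u' E e"
proof
  assume un: "unsettled cl l' u' E e"
  then have e: "e \<in> E" "l' e < u' e" by (auto simp: unsettled_def)
  then have eq: "l' e = l e" "u' e = u e" using assms(1) by (auto simp: refines_def)
  have "{f \<in> E. u f \<le> l e} \<subseteq> {f \<in> E. u' f \<le> l' e}"
       "{f \<in> E. f \<noteq> e \<and> l' f < u' e} \<subseteq> {f \<in> E. f \<noteq> e \<and> l f < u e}"
    using assms(1) eq by (force simp: refines_def)+
  then have "unsettled cl l u E e"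
    using un eq cl_mono unfolding unsettled_def by (metis (no_types, lifting) subsetD)
  then show False using assms(2) by blast
qed

text \<open>No queries to other edges can make \<open>f\<close> surely the smallest across a cut. An
  edge revealed to be at least \<open>u f\<close> is either dispensable for \<open>f\<close> or was
  settled as the largest on a cycle, whose other edges then stand in for it.\<close>

lemma unsettled_max_upper_cl:
  assumes le: "\<And>e. e \<in> E \<Longrightarrow> l e \<le> u e" and "M \<subseteq> E" and ref: "refines l u l' u'"
    and f: "unsettled cl l u M f" and max: "\<And>h. unsettled cl l u M h \<Longrightarrow> u h \<le> u f"
  shows "f \<in> cl {h \<in> M. h \<noteq> f \<and> l' h < u f}"
proof -
  let ?X = "{h \<in> M. h \<noteq> f \<and> l h < u f}"
  let ?R = "{h \<in> M. h \<noteq> f \<and> l' h < u f}"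
  \<comment> \<open>Edges settled as smallest across a cut, with upper limit above
    \<open>u f\<close>. All of \<open>?X\<close> and \<open>f\<close> have lower limits below that,
    so \<open>cl_removal\<close> applies.\<close>
  let ?Z = "{h \<in> M. l h < u h \<and> h \<notin> cl {k \<in> M. k \<noteq> h \<and> l k < u h} \<and> u f < u h}"
  have fX: "f \<in> cl ?X" and fM: "f \<in> M" and lf: "l f < u f" using f by (auto simp: unsettled_def)
  have "finite ?Z" using \<open>M \<subseteq> E\<close> finite_ground by (auto intro: finite_subset)
  moreover have "h \<notin> cl (insert f (?X - {h}))" if h: "h \<in> ?Z" for h
  proof -
    have "insert f (?X - {h}) \<subseteq> {k \<in> M. k \<noteq> h \<and> l k < u h}" using h fM lf by auto
    then show ?thesis using h cl_mono by blast
  qed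
  ultimately have "f \<in> cl (?X - ?Z)" using cl_removal[OF fX] \<open>M \<subseteq> E\<close> by blast
  moreover have "?X - ?Z \<subseteq> cl ?R"
  proof
    fix h assume h: "h \<in> ?X - ?Z"
    then have hE: "h \<in> E" using \<open>M \<subseteq> E\<close> by blast
    show "h \<in> cl ?R"
    proof (cases "l' h < u f")
      case True
      then show ?thesis using h cl_extensive[of ?R] \<open>M \<subseteq> E\<close> by blast
    next
      case False
      then have hu: "u f < u h" "l h < u h" using ref hE h by (force simp: refines_def)+
      then have "h \<in> cl {k \<in> M. k \<noteq> h \<and> l k < u h}" using h by auto
      then have "h \<in> cl {k \<in> M. u k \<le> l h}"
        using max[of h] h hu by (force simp: unsettled_def)
      moreover have "{k \<in> M. u k \<le> l h} \<subseteq> ?R"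
      proof
        fix k assume k: "k \<in> {k \<in> M. u k \<le> l h}"
        then have kE: "k \<in> E" using \<open>M \<subseteq> E\<close> by blast
        have "l' k \<le> u k" using ref kE le[OF kE] by (force simp: refines_def)
        then show "k \<in> ?R" using k h by auto
      qed
      ultimately show ?thesis using cl_mono by blast
    qed
  qed
  moreover have "?R \<subseteq> E" using \<open>M \<subseteq> E\<close> by blast
  ultimately show ?thesis using cl_trans by blast
qed

lemma witness_set_exists:
  assumes le: "\<And>e. e \<in> E \<Longrightarrow> l e \<le> u e" and un: "unsettled cl l u E e0"
  shows "\<exists>W. W \<noteq> {} \<and> card W \<le> 2 \<and> W \<subseteq> {e \<in> E. l e < u e} \<and>
    (\<forall>l' u'. refines l u l' u' \<longrightarrow> (\<forall>e. \<not> unsettled cl l' u' E e) \<longrightarrow>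
       (\<exists>e\<in>W. l' e \<noteq> l e))"
proof -
  txt \<open>
    The initial segments of the order by lower limits, with trivial intervals first among ties, so
    that no later query outside a segment can reveal a weight below a limit inside it. In the first
    segment \<open>M = N \<union> {q}\<close> with an unsettled edge, let \<open>f\<close> be the unsettled edge of largest upper
    limit. If \<open>f \<noteq> q\<close>, it must be queried; otherwise it must be queried or some edge of \<open>N\<close> that \<open>q\<close>
    cannot do without.
  \<close>
  define prefix where "prefix M \<longleftrightarrow> M \<subseteq> E \<and>
    (\<forall>x\<in>M. \<forall>y\<in>E - M. l x \<le> l y \<and> (l x = l y \<longrightarrow> l y = u y \<longrightarrow> l x = u x))" for M
  let ?P = "\<lambda>M. prefix M \<and> (\<exists>e. unsettled cl l u M e)"
  have "?P E" using un by (auto simp: prefix_def)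
  from ex_has_least_nat[of ?P, OF this, of card]
  obtain M where M: "?P M \<and> (\<forall>M'. ?P M' \<longrightarrow> card M \<le> card M')" by (rule exE)
  then have pM: "prefix M" and unM: "\<exists>e. unsettled cl l u M e" by simp_all
  have minM: "card M \<le> card M'" if "prefix M'" "unsettled cl l u M' e" for M' e
    using M that by blast
  have ME: "M \<subseteq> E" using pM by (simp add: prefix_def)
  then have finM: "finite M" using finite_ground by (rule finite_subset)
  have neM: "M \<noteq> {}" using unM by (auto simp: unsettled_def)
  obtain q where qM: "q \<in> M" and q_max: "\<And>x. x \<in> M \<Longrightarrow> l x \<le> l q"
    and q_triv: "\<And>x. x \<in> M \<Longrightarrow> l x = l q \<Longrightarrow> l q = u q \<Longrightarrow> l x = u x"
  proof -
    obtain q where "is_arg_min (\<lambda>h. - l h) (\<lambda>h. h \<in> M) q"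
      using ex_is_arg_min_if_finite[OF finM neM] by blast
    then have q: "q \<in> M" and qm: "\<And>x. x \<in> M \<Longrightarrow> l x \<le> l q"
      by (force simp: is_arg_min_def)+
    show ?thesis
    proof (cases "\<exists>x\<in>M. l x = l q \<and> l x \<noteq> u x")
      case True
      then obtain x where "x \<in> M" "l x = l q" "l x \<noteq> u x" by blast
      then show ?thesis using that[of x] qm by metis
    next
      case False
      then show ?thesis using that[of q] q qm by blast
    qed
  qed
  define N where "N = M - {q}"
  have NM: "M = insert q N" "q \<notin> N" "N \<subseteq> E" using qM ME by (auto simp: N_def)
  have pN: "prefix N"
    unfolding prefix_def
  proof (intro conjI ballI impI)
    fix x y assume x: "x \<in> N" and y: "y \<in> E - N"
    then have yq: "y \<in> E - M \<or> y = q" and xM: "x \<in> M" by (auto simp: N_def)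
    then show "l x \<le> l y" using pM q_max unfolding prefix_def by blast
    show "l x = u x" if "l x = l y" "l y = u y"
      using yq
    proof
      assume "y \<in> E - M"
      then show ?thesis using pM xM that unfolding prefix_def by blast
    qed (use that q_triv[OF xM] in blast)
  qed (use NM in blast)
  have "card N < card M" unfolding N_def using finM qM by (rule card_Diff1_less)
  then have sN: "\<not> unsettled cl l u N h" for h using minM[of N h] pN by auto
  have lN: "\<And>x. x \<in> N \<Longrightarrow> l x \<le> l q" using q_max NM by auto
  \<comment> \<open>Adding \<open>q\<close> to \<open>N\<close> makes some edge unsettled, which
    takes a circuit through \<open>q\<close> within \<open>M\<close>.\<close>
  have qN: "q \<in> cl N"
  proof -
    obtain e where e: "unsettled cl l u M e" using unM by blast
    show ?thesis
    proof (cases "e = q")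
      case True
      then have "q \<in> cl {f \<in> M. f \<noteq> q \<and> l f < u q}" using e by (auto simp: unsettled_def)
      then show ?thesis using cl_mono[of "{f \<in> M. f \<noteq> q \<and> l f < u q}" N] NM by blast
    next
      case False
      let ?Y = "{f \<in> N. f \<noteq> e \<and> l f < u e}"
      have eN: "e \<in> N" "l e < u e" using e False NM by (auto simp: unsettled_def)
      have "e \<notin> cl {f \<in> N. u f \<le> l e}"
        using e NM cl_mono[of "{f \<in> N. u f \<le> l e}" "{f \<in> M. u f \<le> l e}"]
        by (auto simp: unsettled_def)
      then have nY: "e \<notin> cl ?Y" using sN[of e] eN by (auto simp: unsettled_def)
      have "{f \<in> M. f \<noteq> e \<and> l f < u e} \<subseteq> insert q ?Y" using NM by auto
      then have "e \<in> cl (insert q ?Y)" using e cl_mono unfolding unsettled_def by blast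
      then have "q \<in> cl (insert e ?Y)" using exchange[of ?Y q e] nY NM ME by auto
      moreover have "insert e ?Y \<subseteq> N" using eN by auto
      ultimately show ?thesis using cl_mono by blast
    qed
  qed
  obtain f where f: "unsettled cl l u M f" and fmax: "\<And>h. unsettled cl l u M h \<Longrightarrow> u h \<le> u f"
  proof -
    have "finite {h. unsettled cl l u M h}"
      by (rule finite_subset[OF _ finM]) (auto simp: unsettled_def)
    then obtain f where "is_arg_min (\<lambda>h. - u h) (\<lambda>h. h \<in> {h. unsettled cl l u M h}) f"
      using ex_is_arg_min_if_finite[of "{h. unsettled cl l u M h}" "\<lambda>h. - u h"] unM by blast
    then show ?thesis using that[of f] by (force simp: is_arg_min_def)
  qed
  have fM: "f \<in> M" and lf: "l f < u f" and nA: "f \<notin> cl {h \<in> M. u h \<le> l f}"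
    and inB: "f \<in> cl {h \<in> M. h \<noteq> f \<and> l h < u f}"
    using f by (auto simp: unsettled_def)
  have fE: "f \<in> E" using fM ME by blast
  \<comment> \<open>If \<open>f\<close> keeps its interval and everything gets settled,
    \<open>unsettled_max_upper_cl\<close> rules out a cut for \<open>f\<close>, so \<open>f\<close>
    is settled on a cycle; by the order, edges outside \<open>M\<close> never get low enough to take
    part.\<close>
  have low: "f \<in> cl {h \<in> M. u' h \<le> l f}"
    if ref: "refines l u l' u'" and settled: "\<forall>e. \<not> unsettled cl l' u' E e" and eq: "l' f = l f"
    for l' u'
  proof -
    have eq': "u' f = u f" using ref fE eq unfolding refines_def by fastforce
    have "{h \<in> M. h \<noteq> f \<and> l' h < u f} \<subseteq> {h \<in> E. h \<noteq> f \<and> l' h < u' f}" using ME eq' by auto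
    from subsetD[OF cl_mono[OF this] unsettled_max_upper_cl[OF le ME ref f fmax]]
    have "f \<in> cl {h \<in> E. h \<noteq> f \<and> l' h < u' f}" .
    moreover have "\<not> unsettled cl l' u' E f" using settled by blast
    ultimately have "f \<in> cl {h \<in> E. u' h \<le> l f}"
      using eq eq' fE lf by (simp add: unsettled_def)
    moreover have "{h \<in> E. u' h \<le> l f} \<subseteq> {h \<in> M. u' h \<le> l f}"
    proof
      fix h assume h: "h \<in> {h \<in> E. u' h \<le> l f}"
      have "h \<in> M"
      proof (rule ccontr)
        assume "h \<notin> M"
        then have lh: "l f \<le> l h" "l f = l h \<longrightarrow> l h = u h \<longrightarrow> l f = u f"
          using pM h fM by (auto simp: prefix_def)
        have "l' h = l h \<and> u' h = u h \<or> l h < l' h \<and> l' h = u' h \<and> u' h < u h"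
          using ref h unfolding refines_def by blast
        then show False using h lh lf le[of h] by auto
      qed
      then show "h \<in> {h \<in> M. u' h \<le> l f}" using h by auto
    qed
    ultimately show ?thesis using cl_mono by blast
  qed
  show ?thesis
  proof (cases "f = q")
    case False
    then have fN: "f \<in> N" using fM NM by auto
    have "f \<notin> cl {h \<in> N. u h \<le> l f}"
      using nA NM cl_mono[of "{h \<in> N. u h \<le> l f}" "{h \<in> M. u h \<le> l f}"] by auto
    then have nB: "f \<notin> cl {h \<in> N. h \<noteq> f \<and> l h < u f}"
      using sN[of f] fN lf by (auto simp: unsettled_def)
    have "l' f \<noteq> l f" if ref: "refines l u l' u'" and st: "\<forall>e. \<not> unsettled cl l' u' E e" for l' u'
    proof
      assume eq: "l' f = l f"
      have eq': "u' f = u f" using ref fE eq unfolding refines_def by fastforce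
      have "{h \<in> M. u' h \<le> l f} \<subseteq> {h \<in> N. h \<noteq> f \<and> l h < u f}"
      proof
        fix h assume h: "h \<in> {h \<in> M. u' h \<le> l f}"
        then have hE: "h \<in> E" using ME by blast
        have hr: "l' h = l h \<and> u' h = u h \<or> l h < l' h \<and> l' h = u' h \<and> u' h < u h"
          using ref hE unfolding refines_def by blast
        have lh: "l h \<le> l f" using hr h le[OF hE] by auto
        have "h \<noteq> f" using h eq' lf by auto
        moreover have "h \<noteq> q"
        proof
          assume "h = q"
          then have "l f = l q" "l q = u q" using hr h lh lN[OF fN] le[OF hE] by auto
          moreover have "q \<in> E - N" using NM qM ME by blast
          ultimately have "l f = u f" using pN fN unfolding prefix_def by blast
          then show False using lf by simp
        qed
        ultimately show "h \<in> {h \<in> N. h \<noteq> f \<and> l h < u f}" using h lh lf NM by auto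
      qed
      then show False using low[OF ref st eq] nB cl_mono by blast
    qed
    then show ?thesis using fE lf by (intro exI[of _ "{f}"]) auto
  next
    case True
    note fq = this
    \<comment> \<open>Otherwise all edges that might exceed \<open>l q\<close> could be avoided:
      coloops of \<open>N\<close> are dropped by \<open>cl_removal\<close>, and the others, being
      settled in \<open>N\<close>, are spanned by edges surely at most \<open>l q\<close>. Then
      \<open>q\<close> would be settled on a cycle.\<close>
    have "\<exists>g\<in>N. l q < u g \<and> q \<notin> cl (N - {g})"
    proof (rule ccontr)
      assume "\<not> ?thesis"
      then have all: "\<And>g. g \<in> N \<Longrightarrow> l q < u g \<Longrightarrow> q \<in> cl (N - {g})" by blast
      let ?Z = "{h \<in> N. h \<notin> cl (N - {h}) \<and> l q < u h}"
      let ?S = "{h \<in> N. u h \<le> l q}"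
      have "h \<notin> cl (insert q (N - {h}))" if "h \<in> ?Z" for h
        using that all[of h] cl_insert_absorb[of q "N - {h}"] NM by blast
      then have "q \<in> cl (N - ?Z)"
        using cl_removal[OF qN NM(3), of ?Z] NM finite_ground finite_subset by fastforce
      moreover have "N - ?Z \<subseteq> cl ?S"
      proof
        fix h assume h: "h \<in> N - ?Z"
        show "h \<in> cl ?S"
        proof (cases "u h \<le> l q")
          case True
          then show ?thesis using h cl_extensive[of ?S] NM by blast
        next
          case False
          then have hc: "h \<in> cl (N - {h})" "l h < u h" using h lN[of h] by auto
          moreover have "{k \<in> N. k \<noteq> h \<and> l k < u h} = N - {h}" using lN False by force
          ultimately have "h \<in> cl {k \<in> N. u k \<le> l h}"
            using sN[of h] h by (auto simp: unsettled_def)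
          moreover have "{k \<in> N. u k \<le> l h} \<subseteq> ?S" using lN[of h] h by force
          ultimately show ?thesis using cl_mono by blast
        qed
      qed
      moreover have "?S \<subseteq> E" using NM by auto
      ultimately have "q \<in> cl ?S" using cl_trans by blast
      moreover have "?S \<subseteq> {h \<in> M. u h \<le> l f}" using fq NM by auto
      ultimately show False using nA fq cl_mono by blast
    qed
    then obtain g where g: "g \<in> N" "l q < u g" "q \<notin> cl (N - {g})" by blast
    have "\<exists>e\<in>{q, g}. l' e \<noteq> l e"
      if ref: "refines l u l' u'" and st: "\<forall>e. \<not> unsettled cl l' u' E e" for l' u'
    proof (rule ccontr)
      assume "\<not> ?thesis"
      then have eq: "l' q = l q" "l' g = l g" by auto
      have "g \<in> E" "q \<in> E" using g NM qM ME by auto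
      then have "u' g = u g" "u' q = u q" using ref eq unfolding refines_def by fastforce+
      then have "{h \<in> M. u' h \<le> l f} \<subseteq> N - {g}" using fq g NM lf by auto
      then show False using low[OF ref st] eq fq g cl_mono by blast
    qed
    moreover have "card {q, g} \<le> 2" by (simp add: card_insert_if)
    moreover have "l g < u g" using g lN[of g] by simp
    ultimately show ?thesis
      using g NM qM ME lf fq by (intro exI[of _ "{q, g}"]) auto
  qed
qed

end

section \<open>The closure operator of a multigraph\<close>

text \<open>The closure of the graphic matroid. Since reachability is reflexive, a loop lies in the
  closure of every set.\<close>

definition edge_closure :: "('v, 'e, 'z) mgraph_scheme \<Rightarrow> 'e set \<Rightarrow> 'e set" where
  "edge_closure G F =
     {e \<in> edges G. \<forall>u\<in>ends G e. \<forall>v\<in>ends G e. (u, v) \<in> (adjacency G F)\<^sup>*}"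

lemma sym_adjacency: "sym ((adjacency G F)\<^sup>*)"
  by (intro sym_rtrancl) (auto simp: sym_def adjacency_def insert_commute)

lemma adjacency_insert:
  "ends G h = {a, b} \<Longrightarrow> adjacency G (insert h F) = insert (a, b) (insert (b, a) (adjacency G F))"
  by (auto simp: adjacency_def doubleton_eq_iff)

lemma ends_pair:
  assumes "multigraph G" "e \<in> edges G"
  shows "\<exists>a b. ends G e = {a, b}"
proof -
  have "card (ends G e) = 1 \<or> card (ends G e) = 2" using assms by (auto simp: multigraph_def)
  then show ?thesis
    by (metis card_1_singletonE card_2_iff insert_absorb2)
qed

lemma edge_closure_pair:
  assumes "ends G e = {a, b}" "e \<in> edges G"
  shows "e \<in> edge_closure G F \<longleftrightarrow> (a, b) \<in> (adjacency G F)\<^sup>*"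
  using assms sym_adjacency[of G F] by (auto simp: edge_closure_def dest: symD)

lemma rtrancl_insert_swap:
  assumes "(x, y) \<in> (insert (a, b) (insert (b, a) r))\<^sup>*"
  shows "(x, y) \<in> r\<^sup>* \<or> (x, a) \<in> r\<^sup>* \<and> (b, y) \<in> r\<^sup>* \<or> (x, b) \<in> r\<^sup>* \<and> (a, y) \<in> r\<^sup>*"
  using assms
proof (induction rule: rtrancl_induct)
  case base
  then show ?case by simp
next
  case (step y z)
  consider "(y, z) \<in> r" | "y = a" "z = b" | "y = b" "z = a" using step.hyps(2) by auto
  then show ?case
  proof cases
    case 1
    then show ?thesis using step.IH by (meson rtrancl.rtrancl_into_rtrancl)
  qed (use step.IH in auto)
qed

lemma exchange_closure_edges:
  assumes "multigraph G"
  shows "exchange_closure (edges G) (edge_closure G)"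
proof
  show "finite (edges G)" using assms by (simp add: multigraph_def)
  show "edge_closure G F \<subseteq> edges G" for F by (auto simp: edge_closure_def)
  show "F \<subseteq> edge_closure G F" if FE: "F \<subseteq> edges G" for F
  proof
    fix e assume e: "e \<in> F"
    then obtain a b where ab: "ends G e = {a, b}" using ends_pair[OF assms, of e] FE by blast
    have "(a, b) \<in> adjacency G F" using e ab by (auto simp: adjacency_def)
    then show "e \<in> edge_closure G F" using edge_closure_pair[OF ab] e that by blast
  qed
  show "edge_closure G F \<subseteq> edge_closure G F'" if "F \<subseteq> F'" for F F'
  proof -
    have "(adjacency G F)\<^sup>* \<subseteq> (adjacency G F')\<^sup>*"
      using that by (intro rtrancl_mono) (auto simp: adjacency_def)
    then show ?thesis by (auto simp: edge_closure_def)
  qed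
  show "edge_closure G (edge_closure G F) \<subseteq> edge_closure G F" if "F \<subseteq> edges G" for F
  proof -
    have "adjacency G (edge_closure G F) \<subseteq> (adjacency G F)\<^sup>*"
      by (auto simp: adjacency_def edge_closure_def)
    then have "(adjacency G (edge_closure G F))\<^sup>* \<subseteq> (adjacency G F)\<^sup>*"
      by (rule rtrancl_subset_rtrancl)
    then show ?thesis by (auto simp: edge_closure_def)
  qed
  show "h \<in> edge_closure G (insert e F)"
    if FE: "F \<subseteq> edges G" and hE: "h \<in> edges G" and e: "e \<in> edge_closure G (insert h F)" "e \<notin> edge_closure G F"
    for F h e
  proof -
    have eE: "e \<in> edges G" using e by (simp add: edge_closure_def)
    obtain a b where h: "ends G h = {a, b}" using ends_pair[OF assms hE] by blast
    obtain x y where xy: "ends G e = {x, y}" using ends_pair[OF assms eE] by blast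
    let ?r = "adjacency G F" and ?s = "adjacency G (insert e F)"
    have "(x, y) \<in> (insert (a, b) (insert (b, a) ?r))\<^sup>*" "(x, y) \<notin> ?r\<^sup>*"
      using e edge_closure_pair[OF xy eE] adjacency_insert[OF h] by metis+
    \<comment> \<open>The connection of \<open>x\<close> and \<open>y\<close> must use
      \<open>h\<close>, so \<open>F\<close> joins the ends of \<open>e\<close> to those of
      \<open>h\<close>; through \<open>e\<close> the ends of \<open>h\<close> then become
      connected.\<close>
    then have *: "(x, a) \<in> ?r\<^sup>* \<and> (b, y) \<in> ?r\<^sup>* \<or> (x, b) \<in> ?r\<^sup>* \<and> (a, y) \<in> ?r\<^sup>*"
      using rtrancl_insert_swap[of x y a b ?r] by blast
    have rs: "?r\<^sup>* \<subseteq> ?s\<^sup>*" by (intro rtrancl_mono) (auto simp: adjacency_def)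
    have "(x, y) \<in> ?s" using xy by (auto simp: adjacency_def)
    then have xys: "(x, y) \<in> ?s\<^sup>*" ..
    have sy: "sym (?s\<^sup>*)" by (rule sym_adjacency)
    have "(a, b) \<in> ?s\<^sup>*"
      using *
    proof
      assume "(x, a) \<in> ?r\<^sup>* \<and> (b, y) \<in> ?r\<^sup>*"
      then have "(a, x) \<in> ?s\<^sup>*" "(y, b) \<in> ?s\<^sup>*" using rs symD[OF sy] by blast+
      then show ?thesis using xys by (meson rtrancl_trans)
    next
      assume "(x, b) \<in> ?r\<^sup>* \<and> (a, y) \<in> ?r\<^sup>*"
      then show ?thesis using rs symD[OF sy xys] by (meson rtrancl_trans subsetD)
    qed
    then show ?thesis using edge_closure_pair[OF h hE] by blast
  qed
qed

lemma connected_by_iff: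
  assumes "multigraph G" "connected_by G (edges G)" "F \<subseteq> edges G"
  shows "connected_by G F \<longleftrightarrow> edges G \<subseteq> edge_closure G F"
proof
  assume "connected_by G F"
  then show "edges G \<subseteq> edge_closure G F"
    using assms(1) unfolding connected_by_def edge_closure_def multigraph_def by blast
next
  assume "edges G \<subseteq> edge_closure G F"
  then have "adjacency G (edges G) \<subseteq> (adjacency G F)\<^sup>*"
    by (auto simp: adjacency_def edge_closure_def)
  then have "(adjacency G (edges G))\<^sup>* \<subseteq> (adjacency G F)\<^sup>*"
    by (rule rtrancl_subset_rtrancl)
  then show "connected_by G F" using assms(2) by (auto simp: connected_by_def)
qed

section \<open>Simple paths and cycles\<close>

definition is_path :: "('v, 'e, 'z) mgraph_scheme \<Rightarrow> 'v list \<Rightarrow> 'e list \<Rightarrow> bool" where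
  "is_path G vs es \<longleftrightarrow> length vs = Suc (length es) \<and> distinct vs \<and>
     (\<forall>i<length es. ends G (es ! i) = {vs ! i, vs ! Suc i})"

lemma is_path_drop: "is_path G vs es \<Longrightarrow> n \<le> length es \<Longrightarrow> is_path G (drop n vs) (drop n es)"
  by (simp add: is_path_def)

lemma is_path_Cons:
  assumes "is_path G vs es" "ends G e = {x, hd vs}" "x \<notin> set vs"
  shows "is_path G (x # vs) (e # es)"
  unfolding is_path_def
proof (intro conjI allI impI)
  have ne: "vs \<noteq> []" and vs: "length vs = Suc (length es)" "distinct vs"
    using assms(1) by (auto simp: is_path_def)
  show "length (x # vs) = Suc (length (e # es))" "distinct (x # vs)" using vs assms(3) by simp_all
  show "ends G ((e # es) ! i) = {(x # vs) ! i, (x # vs) ! Suc i}" if "i < length (e # es)" for i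
    using that assms(1,2) ne by (cases i) (simp_all add: is_path_def hd_conv_nth)
qed

lemma path_exists:
  assumes "(x, y) \<in> (adjacency G F)\<^sup>*"
  shows "\<exists>vs es. is_path G vs es \<and> hd vs = x \<and> last vs = y \<and> set es \<subseteq> F"
  using assms
proof (induction rule: converse_rtrancl_induct)
  case base
  show ?case by (intro exI[of _ "[y]"] exI[of _ "[]"]) (simp add: is_path_def)
next
  case (step x z)
  then obtain vs es where p: "is_path G vs es" "hd vs = z" "last vs = y" "set es \<subseteq> F" by blast
  obtain e where e: "e \<in> F" "ends G e = {x, z}" using step.hyps(1) by (auto simp: adjacency_def)
  show ?case
  proof (cases "x \<in> set vs")
    case True
    \<comment> \<open>The new vertex is already on the path: only the part from its occurrence on is
      kept.\<close>
    then obtain n where n: "n < length vs" "vs ! n = x" by (auto simp: in_set_conv_nth)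
    then have "n \<le> length es" using p(1) by (simp add: is_path_def)
    then have "is_path G (drop n vs) (drop n es)" using is_path_drop[OF p(1)] by blast
    moreover have "hd (drop n vs) = x" "last (drop n vs) = y"
      using n p(3) by (simp_all add: hd_drop_conv_nth)
    moreover have "set (drop n es) \<subseteq> F" using p(4) set_drop_subset[of n es] by blast
    ultimately show ?thesis by blast
  next
    case False
    have "vs \<noteq> []" using p(1) by (auto simp: is_path_def)
    then have "hd (x # vs) = x" "last (x # vs) = y" "set (e # es) \<subseteq> F" using p e by simp_all
    then show ?thesis using is_path_Cons[OF p(1) _ False, of e] p(2) e(2) by blast
  qed
qed

lemma distinct_path_edges: "distinct es" if "is_path G vs es"
proof -
  have "es ! i \<noteq> es ! j" if ij: "i < length es" "j < length es" "i < j" for i j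
  proof
    assume "es ! i = es ! j"
    then have "{vs ! i, vs ! Suc i} = {vs ! j, vs ! Suc j}"
      using ij \<open>is_path G vs es\<close> unfolding is_path_def by metis
    then have "vs ! i = vs ! j \<or> vs ! i = vs ! Suc j" by blast
    then show False
      using ij \<open>is_path G vs es\<close> by (auto simp: is_path_def nth_eq_iff_index_eq)
  qed
  then show ?thesis unfolding distinct_conv_nth by (metis nat_neq_iff)
qed

text \<open>An edge spanned by the others closes a simple path between its ends to a cycle (a loop
  is one by itself); conversely, the other edges of a cycle connect the ends of its last
  edge.\<close>

lemma acyclic_iff_independent:
  assumes "multigraph G" "F \<subseteq> edges G"
  shows "acyclic_edges G F \<longleftrightarrow> independent (edge_closure G) F"
proof (rule iffI; rule ccontr)
  assume ac: "acyclic_edges G F" and "\<not> independent (edge_closure G) F"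
  then obtain e where e: "e \<in> F" "e \<in> edge_closure G (F - {e})" by (auto simp: independent_def)
  obtain x y where xy: "ends G e = {x, y}" using ends_pair[OF assms(1), of e] assms(2) e by blast
  show False
  proof (cases "x = y")
    case True
    then have "is_cycle G [x] [e]" using xy by (simp add: is_cycle_def)
    then show False using ac e unfolding acyclic_edges_def by force
  next
    case False
    have "(x, y) \<in> (adjacency G (F - {e}))\<^sup>*" using e edge_closure_pair[OF xy] assms by blast
    then obtain vs es where p: "is_path G vs es" "hd vs = x" "last vs = y" "set es \<subseteq> F - {e}"
      using path_exists by metis
    have len: "length vs = Suc (length es)" "vs \<noteq> []" using p(1) by (auto simp: is_path_def)
    have "distinct (es @ [e])" using distinct_path_edges[OF p(1)] p(4) by auto
    moreover have "ends G ((es @ [e]) ! i) = {vs ! i, vs ! (Suc i mod length (es @ [e]))}"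
      if i: "i < length (es @ [e])" for i
    proof (cases "i < length es")
      case True
      then show ?thesis using p(1) by (auto simp: is_path_def nth_append)
    next
      case False
      then have "i = length es" using i by simp
      moreover have "vs ! 0 = x" "vs ! length es = y"
        using p(2,3) len by (simp_all add: hd_conv_nth last_conv_nth)
      ultimately show ?thesis using xy by (auto simp: nth_append)
    qed
    ultimately have "is_cycle G vs (es @ [e])" using p(1) by (simp add: is_cycle_def is_path_def)
    moreover have "set (es @ [e]) \<subseteq> F" using p e by auto
    ultimately show False using ac unfolding acyclic_edges_def by blast
  qed
next
  assume ind: "independent (edge_closure G) F" and "\<not> acyclic_edges G F"
  then obtain vs es where c: "is_cycle G vs es" "set es \<subseteq> F" by (auto simp: acyclic_edges_def)
  let ?n = "length es - 1"
  let ?e = "es ! ?n"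
  have n: "?n < length es" "Suc ?n = length es" using c(1) by (auto simp: is_cycle_def)
  have "(vs ! 0, vs ! k) \<in> (adjacency G (F - {?e}))\<^sup>*" if "k \<le> ?n" for k
    using that
  proof (induction k)
    case (Suc k)
    have k: "k < length es" "k \<noteq> ?n" "Suc k mod length es = Suc k" using Suc.prems n by auto
    then have "es ! k \<in> F - {?e}"
      using c n(1) by (auto simp: is_cycle_def nth_eq_iff_index_eq)
    moreover have "ends G (es ! k) = {vs ! k, vs ! Suc k}"
      using c(1) k by (auto simp: is_cycle_def)
    ultimately have "(vs ! k, vs ! Suc k) \<in> adjacency G (F - {?e})" by (auto simp: adjacency_def)
    then show ?case using Suc by (meson Suc_leD rtrancl.rtrancl_into_rtrancl)
  qed simp
  then have "(vs ! 0, vs ! ?n) \<in> (adjacency G (F - {?e}))\<^sup>*" by blast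
  moreover have "ends G ?e = {vs ! ?n, vs ! (Suc ?n mod length es)}"
    using c(1) n(1) unfolding is_cycle_def by blast
  then have "ends G ?e = {vs ! 0, vs ! ?n}" using n(2) by (simp add: insert_commute)
  moreover have eF: "?e \<in> F" using c(2) n(1) nth_mem by blast
  ultimately have "?e \<in> edge_closure G (F - {?e})"
    using edge_closure_pair[of G ?e] assms(2) by blast
  then show False using ind eF by (auto simp: independent_def)
qed

lemma is_mst_iff:
  assumes "multigraph G" "connected_by G (edges G)"
  shows "is_mst G w T \<longleftrightarrow> exchange_closure.min_basis (edges G) (edge_closure G) w T"
proof -
  interpret exchange_closure "edges G" "edge_closure G"
    by (rule exchange_closure_edges[OF assms(1)])
  have "spanning_tree G T \<longleftrightarrow> basis T" for T
    using connected_by_iff[OF assms, of T] acyclic_iff_independent[OF assms(1), of T]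
    by (auto simp: spanning_tree_def basis_def)
  then show ?thesis by (simp add: is_mst_def min_basis_def)
qed

section \<open>Feasible query sets\<close>

definition known_lower :: "('v, 'e) mst_input \<Rightarrow> ('e \<Rightarrow> real) \<Rightarrow> 'e set \<Rightarrow> 'e \<Rightarrow> real" where
  "known_lower G w Q e = (if e \<in> Q then w e else lower G e)"

definition known_upper :: "('v, 'e) mst_input \<Rightarrow> ('e \<Rightarrow> real) \<Rightarrow> 'e set \<Rightarrow> 'e \<Rightarrow> real" where
  "known_upper G w Q e = (if e \<in> Q then w e else upper G e)"

definition unresolved :: "('v, 'e) mst_input \<Rightarrow> ('e \<Rightarrow> real) \<Rightarrow> 'e set \<Rightarrow> 'e \<Rightarrow> bool" where
  "unresolved G w Q e \<longleftrightarrow>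
     unsettled (edge_closure G) (known_lower G w Q) (known_upper G w Q) (edges G) e"

definition resolved :: "('v, 'e) mst_input \<Rightarrow> ('e \<Rightarrow> real) \<Rightarrow> 'e set \<Rightarrow> bool" where
  "resolved G w Q \<longleftrightarrow> (\<forall>e. \<not> unresolved G w Q e)"

lemma interval_cases:
  assumes "x \<in> interval G e"
  shows "lower G e = upper G e \<and> x = lower G e \<or> lower G e < x \<and> x < upper G e"
  using assms by (auto simp: interval_def split: if_splits)

lemma realizes_known:
  assumes "\<And>e. e \<in> edges G \<Longrightarrow> w e \<in> interval G e"
  shows "realizes (edges G) (known_lower G w Q) (known_upper G w Q) w' \<longleftrightarrow>
    (\<forall>e\<in>edges G \<inter> Q. w' e = w e) \<and> (\<forall>e\<in>edges G - Q. w' e \<in> interval G e)"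
  unfolding realizes_def known_lower_def known_upper_def interval_def by force

text \<open>Turns the quantification over weight assignments into a finite test on limits. In the
  backward direction any minimum spanning tree for the true weights serves as
  \<open>T\<close>.\<close>

lemma feasible_iff_resolved:
  assumes "mst_instance G w" "Q \<subseteq> edges G"
  shows "feasible G w Q \<longleftrightarrow> resolved G w Q"
proof -
  have G: "multigraph G" "connected_by G (edges G)"
    and w: "\<And>e. e \<in> edges G \<Longrightarrow> w e \<in> interval G e"
    using assms(1) by (auto simp: mst_instance_def)
  interpret exchange_closure "edges G" "edge_closure G"
    by (rule exchange_closure_edges[OF G(1)])
  let ?R = "realizes (edges G) (known_lower G w Q) (known_upper G w Q)"
  have R: "?R w' \<longleftrightarrow> (\<forall>e\<in>Q. w' e = w e) \<and> (\<forall>e\<in>edges G - Q. w' e \<in> interval G e)" for w'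
    using realizes_known[OF w] assms(2) by (simp add: Int_absorb1)
  have Rw: "?R w" using R w by blast
  have "feasible G w Q \<longleftrightarrow> (\<exists>T. \<forall>w'. ?R w' \<longrightarrow> min_basis w' T)"
    using assms(2) by (simp add: feasible_def R is_mst_iff[OF G])
  also have "\<dots> \<longleftrightarrow> resolved G w Q"
    unfolding resolved_def unresolved_def
    using settled_if_min_basis[OF Rw] min_basis_if_settled[OF Rw] min_basis_exists by blast
  finally show ?thesis .
qed

lemma refines_known:
  assumes "multigraph G" "\<And>e. e \<in> edges G \<Longrightarrow> w e \<in> interval G e" "Q \<subseteq> Q'"
  shows "exchange_closure.refines (edges G) (known_lower G w Q) (known_upper G w Q)
           (known_lower G w Q') (known_upper G w Q')"
proof -
  interpret exchange_closure "edges G" "edge_closure G"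
    by (rule exchange_closure_edges[OF assms(1)])
  show ?thesis
    unfolding refines_def
  proof
    fix e assume e: "e \<in> edges G"
    show "known_lower G w Q' e = known_lower G w Q e \<and> known_upper G w Q' e = known_upper G w Q e \<or>
      known_lower G w Q e < known_lower G w Q' e \<and> known_lower G w Q' e = known_upper G w Q' e \<and>
      known_upper G w Q' e < known_upper G w Q e"
      using interval_cases[OF assms(2)[OF e]] assms(3) by (auto simp: known_lower_def known_upper_def)
  qed
qed

lemma resolved_mono:
  assumes "multigraph G" "\<And>e. e \<in> edges G \<Longrightarrow> w e \<in> interval G e" "Q \<subseteq> Q'" "resolved G w Q"
  shows "resolved G w Q'"
proof -
  interpret exchange_closure "edges G" "edge_closure G"
    by (rule exchange_closure_edges[OF assms(1)])
  show ?thesis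
    using settled_refines[OF refines_known[OF assms(1-3)]] assms(4)
    by (auto simp: resolved_def unresolved_def)
qed

text \<open>Ranging over all weights compatible with the answers on \<open>Q\<close> makes the
  notion depend on those answers only, so that an algorithm can evaluate it.\<close>

definition witness_set :: "('v, 'e) mst_input \<Rightarrow> ('e \<Rightarrow> real) \<Rightarrow> 'e set \<Rightarrow> 'e set \<Rightarrow> bool" where
  "witness_set G w Q W \<longleftrightarrow> W \<noteq> {} \<and> card W \<le> 2 \<and> W \<subseteq> edges G - Q \<and>
     (\<forall>w' S. (\<forall>e\<in>edges G. w' e \<in> interval G e) \<and> (\<forall>e\<in>Q. w' e = w e) \<and> S \<subseteq> edges G \<and> resolved G w' S
        \<longrightarrow> W \<inter> S \<noteq> {})"

lemma known_cong:
  assumes "\<And>e. e \<in> Q \<Longrightarrow> w' e = w e"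
  shows "known_lower G w' Q = known_lower G w Q" "known_upper G w' Q = known_upper G w Q"
  using assms by (auto simp: known_lower_def known_upper_def)

lemma resolved_cong:
  assumes "\<And>e. e \<in> Q \<Longrightarrow> w' e = w e"
  shows "resolved G w' Q = resolved G w Q"
  by (simp add: resolved_def unresolved_def known_cong[of Q w' w, OF assms])

lemma witness_set_cong:
  assumes "\<And>e. e \<in> Q \<Longrightarrow> w' e = w e"
  shows "witness_set G w' Q = witness_set G w Q"
proof -
  have "(\<forall>e\<in>Q. v e = w' e) \<longleftrightarrow> (\<forall>e\<in>Q. v e = w e)" for v using assms by auto
  then show ?thesis unfolding witness_set_def by presburger
qed

lemma witness_set_if_unresolved:
  assumes "multigraph G" "\<And>e. e \<in> edges G \<Longrightarrow> w e \<in> interval G e" "\<not> resolved G w Q"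
  shows "\<exists>W. witness_set G w Q W"
proof -
  interpret exchange_closure "edges G" "edge_closure G"
    by (rule exchange_closure_edges[OF assms(1)])
  let ?l = "known_lower G w Q" and ?u = "known_upper G w Q"
  obtain e0 where un: "unsettled (edge_closure G) ?l ?u (edges G) e0"
    using assms(3) by (auto simp: resolved_def unresolved_def)
  have le: "?l e \<le> ?u e" if "e \<in> edges G" for e
    using interval_cases[OF assms(2)[OF that]] by (auto simp: known_lower_def known_upper_def)
  from witness_set_exists[OF le un] obtain W where
    "W \<noteq> {} \<and> card W \<le> 2 \<and> W \<subseteq> {e \<in> edges G. ?l e < ?u e} \<and>
     (\<forall>l' u'. refines ?l ?u l' u' \<longrightarrow> (\<forall>e. \<not> unsettled (edge_closure G) l' u' (edges G) e)
        \<longrightarrow> (\<exists>e\<in>W. l' e \<noteq> ?l e))"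
    by (rule exE)
  then have W: "W \<noteq> {}" "card W \<le> 2" "W \<subseteq> {e \<in> edges G. ?l e < ?u e}"
    and meet: "\<And>l' u'. refines ?l ?u l' u' \<Longrightarrow> \<forall>e. \<not> unsettled (edge_closure G) l' u' (edges G) e
       \<Longrightarrow> \<exists>e\<in>W. l' e \<noteq> ?l e"
    by blast+
  have WQ: "W \<subseteq> edges G - Q" using W(3) by (auto simp: known_lower_def known_upper_def split: if_splits)
  have "W \<inter> S \<noteq> {}"
    if w': "\<forall>e\<in>edges G. w' e \<in> interval G e" "\<forall>e\<in>Q. w' e = w e" and S: "resolved G w' S" for w' S
  proof -
    have w'_in: "\<And>e. e \<in> edges G \<Longrightarrow> w' e \<in> interval G e" using w' by blast
    have eq: "known_lower G w' Q = ?l" "known_upper G w' Q = ?u" using known_cong[of Q w' w] w' by simp_all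
    \<comment> \<open>\<open>S\<close> need not contain \<open>Q\<close>, so the union is
      considered: its knowledge refines that of \<open>Q\<close>, and an edge of \<open>W\<close>
      whose limit it changes must come from \<open>S\<close>.\<close>
    have ref: "refines ?l ?u (known_lower G w' (Q \<union> S)) (known_upper G w' (Q \<union> S))"
      using refines_known[OF assms(1) w'_in, of Q "Q \<union> S"] eq by simp
    have "resolved G w' (Q \<union> S)" using resolved_mono[OF assms(1) w'_in _ S] by simp
    then have "\<forall>e. \<not> unsettled (edge_closure G) (known_lower G w' (Q \<union> S))
        (known_upper G w' (Q \<union> S)) (edges G) e"
      unfolding resolved_def unresolved_def .
    from meet[OF ref this] obtain e where e: "e \<in> W" "known_lower G w' (Q \<union> S) e \<noteq> ?l e" by blast
    then have "e \<notin> Q" using WQ by blast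
    then have "e \<in> S" using e(2) unfolding known_lower_def by (metis UnE)
    then show ?thesis using e(1) by blast
  qed
  then have "witness_set G w Q W" unfolding witness_set_def using W(1,2) WQ by blast
  then show ?thesis ..
qed

section \<open>Hop errors\<close>

text \<open>Collects the edges \<open>e'\<close> whose limits are crossed, not those with a wrong
  prediction: feasibility compares weights with limits, and these are the limits where the
  comparison may differ.\<close>

definition hop_errors :: "('v, 'e) mst_input \<Rightarrow> ('e \<Rightarrow> real) \<Rightarrow> 'e set" where
  "hop_errors G w = {e' \<in> edges G. \<exists>e\<in>edges G - {e'}. hop G w e' e \<noteq> 0}"

lemma card_hop_errors:
  assumes "finite (edges G)"
  shows "card (hop_errors G w) \<le> hop_distance G w"
proof -
  have fin: "finite (hop_errors G w)" and sub: "hop_errors G w \<subseteq> edges G"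
    using assms by (auto simp: hop_errors_def)
  have "card (hop_errors G w) = (\<Sum>e'\<in>hop_errors G w. 1)" by simp
  also have "\<dots> \<le> (\<Sum>e'\<in>hop_errors G w. \<Sum>e\<in>edges G - {e'}. hop G w e' e)"
  proof (rule sum_mono)
    fix e' assume "e' \<in> hop_errors G w"
    then obtain e where e: "e \<in> edges G - {e'}" "hop G w e' e \<noteq> 0"
      unfolding hop_errors_def by blast
    then have "1 \<le> hop G w e' e" by simp
    also have "\<dots> \<le> (\<Sum>e\<in>edges G - {e'}. hop G w e' e)"
      using e(1) assms by (intro member_le_sum) auto
    finally show "1 \<le> (\<Sum>e\<in>edges G - {e'}. hop G w e' e)" .
  qed
  also have "\<dots> \<le> (\<Sum>e'\<in>edges G. \<Sum>e\<in>edges G - {e'}. hop G w e' e)"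
    using sub assms by (intro sum_mono2) auto
  also have "\<dots> = (\<Sum>e'\<in>edges G. \<Sum>e | e \<in> edges G \<and> e \<noteq> e'. hop G w e' e)"
    by (intro sum.cong) auto
  also have "\<dots> = (\<Sum>e\<in>edges G. \<Sum>e' | e' \<in> edges G \<and> e \<noteq> e'. hop G w e' e)"
    by (rule sum.swap_restrict[OF assms assms])
  also have "\<dots> = hop_distance G w"
    unfolding hop_distance_def by (intro sum.cong) auto
  finally show ?thesis .
qed

text \<open>The regions of a nontrivial interval are disjoint, so a common region decides both
  comparisons; the shared point of a trivial interval would spoil this.\<close>

lemma hop_zero_iff:
  assumes "hop G w e' e = 0" "lower G e' < upper G e'"
  shows "pred G e \<le> lower G e' \<longleftrightarrow> w e \<le> lower G e'" "pred G e < upper G e' \<longleftrightarrow> w e < upper G e'"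
  using assms by (auto simp: hop_def split: if_splits)

text \<open>No hop error occurs at an unqueried edge, so its tests treat predicted and true weights
  of queried edges alike; unqueried edges enter with their limits in both cases.\<close>

lemma resolved_pred_iff:
  assumes "hop_errors G w \<subseteq> Q" "Q \<subseteq> edges G"
  shows "resolved G (pred G) Q \<longleftrightarrow> resolved G w Q"
proof -
  have "unresolved G (pred G) Q e \<longleftrightarrow> unresolved G w Q e" for e
  proof (cases "e \<in> edges G \<and> e \<notin> Q \<and> lower G e < upper G e")
    case True
    have hop: "hop G w e f = 0" if "f \<in> Q" for f
    proof (rule ccontr)
      assume "hop G w e f \<noteq> 0"
      moreover have "f \<in> edges G - {e}" using that True assms(2) by blast
      ultimately have "e \<in> hop_errors G w" using True unfolding hop_errors_def by blast
      then show False using True assms(1) by blast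
    qed
    have "{f \<in> edges G. known_upper G (pred G) Q f \<le> lower G e}
        = {f \<in> edges G. known_upper G w Q f \<le> lower G e}"
      using hop_zero_iff(1)[OF hop] True by (auto simp: known_upper_def)
    moreover have "{f \<in> edges G. f \<noteq> e \<and> known_lower G (pred G) Q f < upper G e}
        = {f \<in> edges G. f \<noteq> e \<and> known_lower G w Q f < upper G e}"
      using hop_zero_iff(2)[OF hop] True by (auto simp: known_lower_def)
    moreover have "known_lower G v Q e = lower G e" "known_upper G v Q e = upper G e" for v
      using True by (auto simp: known_lower_def known_upper_def)
    ultimately show ?thesis by (simp add: unresolved_def unsettled_def)
  next
    case False
    then have "\<not> known_lower G v Q e < known_upper G v Q e \<or> e \<notin> edges G" for v
      by (auto simp: known_lower_def known_upper_def)
    then show ?thesis unfolding unresolved_def unsettled_def by blast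
  qed
  then show ?thesis by (simp add: resolved_def)
qed


section \<open>Algorithms that query in batches\<close>

text \<open>An \<open>algorithm\<close> sees only the history, so the internal state is recomputed
  by replaying the batches: \<open>past\<close> holds the answers to finished batches,
  \<open>rest\<close> those still to be assigned. An empty batch means stop.\<close>

function batch_algorithm ::
    "('s \<Rightarrow> ('e \<times> real) list \<Rightarrow> 'e list \<times> 's) \<Rightarrow> 's \<Rightarrow> ('e \<times> real) list \<Rightarrow> ('e \<times> real) list \<Rightarrow> 'e option"
where
  "batch_algorithm S s past rest =
     (let b = fst (S s past); n = length b in
      if b = [] then None
      else if length rest < n then Some (b ! length rest)
      else batch_algorithm S (snd (S s past)) (past @ take n rest) (drop n rest))"
  by pat_completeness auto
termination
  by (relation "Wellfounded.measure (\<lambda>(S, s, past, rest). length rest)")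
     (auto simp: not_less intro!: diff_less intro: less_le_trans)

declare batch_algorithm.simps [simp del]

inductive batch_run ::
    "('s \<Rightarrow> ('e \<times> real) list \<Rightarrow> 'e list \<times> 's) \<Rightarrow> 's \<Rightarrow> ('e \<Rightarrow> real) \<Rightarrow> 's \<Rightarrow> ('e \<times> real) list \<Rightarrow> bool"
  for S s0 w
where
  start: "batch_run S s0 w s0 []"
| step: "batch_run S s0 w s h \<Longrightarrow> S s h = (b, s') \<Longrightarrow> b \<noteq> [] \<Longrightarrow>
    batch_run S s0 w s' (h @ map (\<lambda>e. (e, w e)) b)"

lemma batch_algorithm_run:
  assumes "batch_run S s0 w s h"
  shows "batch_algorithm S s0 [] (h @ r) = batch_algorithm S s h r"
  using assms
proof (induction arbitrary: r)
  case (step s h b s')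
  then show ?case
    by (simp add: batch_algorithm.simps[of S s h] Let_def)
qed simp

lemma transcript_batch_run:
  assumes "batch_run (S G) s0 w s h"
  shows "transcript (\<lambda>G h. batch_algorithm (S G) s0 [] h) G w h"
  using assms
proof (induction)
  case start
  show ?case by (rule transcript.start)
next
  case (step s h b s')
  \<comment> \<open>Induction within the batch: after \<open>k\<close> of its answers, the replay
    arrives at this batch and names the entry at position \<open>k\<close>.\<close>
  have "transcript (\<lambda>G h. batch_algorithm (S G) s0 [] h) G w (h @ map (\<lambda>e. (e, w e)) (take k b))"
    if "k \<le> length b" for k
    using that
  proof (induction k)
    case 0
    then show ?case using step.IH by simp
  next
    case (Suc k)
    let ?h = "h @ map (\<lambda>e. (e, w e)) (take k b)"
    have "batch_algorithm (S G) s0 [] ?h = Some (b ! k)"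
      using Suc.prems step.hyps
      by (simp add: batch_algorithm_run[OF step.hyps(1)] batch_algorithm.simps[of "S G" s h] Let_def)
    then have "transcript (\<lambda>G h. batch_algorithm (S G) s0 [] h) G w (?h @ [(b ! k, w (b ! k))])"
      using Suc by (intro transcript.query) simp_all
    then show ?case using Suc.prems by (simp add: take_Suc_conv_app_nth)
  qed
  from this[of "length b"] show ?case by simp
qed

lemma queries_batch_run:
  assumes "batch_run (S G) s0 w s h" "fst (S G s h) = []"
  shows "queries (\<lambda>G h. batch_algorithm (S G) s0 [] h) G w (fst ` set h)"
proof -
  have "batch_algorithm (S G) s0 [] h = None"
    using batch_algorithm_run[OF assms(1), of "[]"] assms(2)
    by (simp add: batch_algorithm.simps[of "S G" s h] Let_def)
  then show ?thesis unfolding queries_def using transcript_batch_run[of S, OF assms(1)] by blast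
qed


section \<open>The algorithm\<close>

definition predicted_optimum :: "('v, 'e) mst_input \<Rightarrow> 'e set" where
  "predicted_optimum G = (SOME F. F \<subseteq> edges G \<and> resolved G (pred G) F \<and>
     (\<forall>Q. Q \<subseteq> edges G \<longrightarrow> resolved G (pred G) Q \<longrightarrow> card F \<le> card Q))"

text \<open>
  The flag tells that a block of predicted edges has just been queried, so that a witness set is
  due.
\<close>

definition next_batch ::
    "nat \<Rightarrow> ('v, 'e) mst_input \<Rightarrow> ('e \<Rightarrow> real) \<Rightarrow> bool \<Rightarrow> 'e set \<Rightarrow> 'e set \<times> bool" where
  "next_batch \<gamma> G w s Q =
     (let R = predicted_optimum G - Q in
      if resolved G w Q then ({}, s)
      else if \<not> s \<and> R \<noteq> {} then (SOME P. P \<subseteq> R \<and> card P = min (\<gamma> - 1) (card R), True)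
      else (SOME W. witness_set G w Q W, False))"

text \<open>Unspecified outside the history, which is harmless because by
  \<open>next_batch_cong\<close> only queried edges matter.\<close>

definition answers :: "('e \<times> real) list \<Rightarrow> 'e \<Rightarrow> real" where
  "answers h e = the (map_of h e)"

definition strategy ::
    "nat \<Rightarrow> ('v, 'e) mst_input \<Rightarrow> bool \<Rightarrow> ('e \<times> real) list \<Rightarrow> 'e list \<times> bool" where
  "strategy \<gamma> G s h =
     (let (P, s') = next_batch \<gamma> G (answers h) s (fst ` set h)
      in (SOME xs. set xs = P \<and> distinct xs, s'))"

lemma next_batch_cong:
  assumes "\<And>e. e \<in> Q \<Longrightarrow> w' e = w e"
  shows "next_batch \<gamma> G w' s Q = next_batch \<gamma> G w s Q"
proof -
  have "resolved G w' Q = resolved G w Q" using assms by (rule resolved_cong)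
  moreover have "witness_set G w' Q = witness_set G w Q" using assms by (rule witness_set_cong)
  ultimately show ?thesis unfolding next_batch_def by presburger
qed

lemma batch_run_answers:
  assumes "batch_run S s0 w s h"
  shows "\<forall>x\<in>set h. snd x = w (fst x)"
  using assms by induction auto

lemma strategy_next_batch:
  assumes "batch_run (strategy \<gamma> G) s0 w s h" "next_batch \<gamma> G w s (fst ` set h) = (P, s')" "finite P"
  shows "\<exists>xs. strategy \<gamma> G s h = (xs, s') \<and> set xs = P"
proof -
  have "answers h e = w e" if e: "e \<in> fst ` set h" for e
  proof -
    obtain y where y: "map_of h e = Some y" using e by (metis map_of_eq_None_iff option.exhaust)
    then show ?thesis
      using batch_run_answers[OF assms(1)] map_of_SomeD[OF y] by (fastforce simp add: answers_def)
  qed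
  then have "next_batch \<gamma> G (answers h) s (fst ` set h) = next_batch \<gamma> G w s (fst ` set h)"
    by (rule next_batch_cong)
  then have nb: "next_batch \<gamma> G (answers h) s (fst ` set h) = (P, s')" unfolding assms(2) .
  have "set (SOME xs. set xs = P \<and> distinct xs) = P"
    using someI_ex[OF finite_distinct_list[OF assms(3)]] by blast
  then show ?thesis unfolding strategy_def nb by simp
qed

section \<open>Correctness and cost of the algorithm on a fixed instance\<close>

locale query_instance =
  fixes G :: "('v, 'e) mst_input" and w :: "'e \<Rightarrow> real" and \<gamma> :: nat
  assumes inst: "mst_instance G w" and gamma: "\<gamma> \<ge> 2"
begin

abbreviation "E \<equiv> edges G"
abbreviation "F \<equiv> predicted_optimum G"

lemma mgraph: "multigraph G"
  using inst by (simp add: mst_instance_def)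

lemma finite_edges: "finite E"
  using mgraph by (simp add: multigraph_def)

lemma w_interval: "e \<in> E \<Longrightarrow> w e \<in> interval G e"
  and pred_interval: "e \<in> E \<Longrightarrow> pred G e \<in> interval G e"
  using inst by (simp_all add: mst_instance_def)

lemma resolved_edges: "resolved G v E"
proof -
  have "\<not> known_lower G v E e < known_upper G v E e" if "e \<in> E" for e
    using that by (simp add: known_lower_def known_upper_def)
  then show ?thesis unfolding resolved_def unresolved_def unsettled_def by blast
qed

lemma predicted_optimum:
  "F \<subseteq> E" "resolved G (pred G) F"
  "\<And>Q. Q \<subseteq> E \<Longrightarrow> resolved G (pred G) Q \<Longrightarrow> card F \<le> card Q"
proof -
  let ?P = "\<lambda>Q. Q \<subseteq> E \<and> resolved G (pred G) Q"
  have "?P E" using resolved_edges by blast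
  from ex_has_least_nat[of ?P, OF this, of card]
  obtain F0 where "?P F0 \<and> (\<forall>Q. ?P Q \<longrightarrow> card F0 \<le> card Q)" by (rule exE)
  then have "\<exists>F. F \<subseteq> E \<and> resolved G (pred G) F \<and>
     (\<forall>Q. Q \<subseteq> E \<longrightarrow> resolved G (pred G) Q \<longrightarrow> card F \<le> card Q)" by blast
  from someI_ex[OF this, folded predicted_optimum_def]
  show "F \<subseteq> E" "resolved G (pred G) F"
    "\<And>Q. Q \<subseteq> E \<Longrightarrow> resolved G (pred G) Q \<Longrightarrow> card F \<le> card Q" by blast+
qed

lemma next_batch_cases:
  assumes "\<not> resolved G w Q"
  obtains (predicted) P where "next_batch \<gamma> G w s Q = (P, True)" "\<not> s" "P \<noteq> {}" "P \<subseteq> F - Q"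
      "card P = min (\<gamma> - 1) (card (F - Q))"
  | (witness) W where "next_batch \<gamma> G w s Q = (W, False)" "s \<or> F \<subseteq> Q" "witness_set G w Q W"
proof (cases "\<not> s \<and> F - Q \<noteq> {}")
  case True
  let ?C = "\<lambda>P. P \<subseteq> F - Q \<and> card P = min (\<gamma> - 1) (card (F - Q))"
  define P where "P = (SOME P. ?C P)"
  have "\<exists>P. ?C P" using obtain_subset_with_card_n[of "min (\<gamma> - 1) (card (F - Q))" "F - Q"]
    by (metis min.cobounded2)
  then have P: "?C P" unfolding P_def by (rule someI_ex)
  have "finite (F - Q)" using predicted_optimum(1) finite_edges finite_subset by blast
  then have "card (F - Q) > 0" using True by (simp add: card_gt_0_iff)
  then have "P \<noteq> {}" using P gamma by (auto simp: min_def split: if_splits)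
  moreover have "next_batch \<gamma> G w s Q = (P, True)"
    using True assms unfolding next_batch_def P_def by (simp add: Let_def)
  ultimately show ?thesis using predicted True P by blast
next
  case False
  have "witness_set G w Q (SOME W. witness_set G w Q W)"
    using witness_set_if_unresolved[OF mgraph w_interval assms] by (rule someI_ex)
  moreover have "next_batch \<gamma> G w s Q = (SOME W. witness_set G w Q W, False)"
    unfolding next_batch_def Let_def if_not_P[OF assms] if_not_P[OF False] ..
  ultimately show ?thesis using witness False by blast
qed

text \<open>
  Here \<open>S\<close> is a feasible set and \<open>D\<close> a feasible superset of \<open>F\<close>. So far there were \<open>k\<close> full
  rounds (\<open>\<gamma> - 1\<close> edges of \<open>F\<close> and a witness set), and \<open>m\<close> rounds whose witness set was
  queried after \<open>F\<close> had been exhausted; every witness set meets both \<open>S\<close> and \<open>D\<close>.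
\<close>

definition budget :: "'e set \<Rightarrow> 'e set \<Rightarrow> bool \<Rightarrow> 'e set \<Rightarrow> nat \<Rightarrow> nat \<Rightarrow> bool" where
  "budget S D s Q k m \<longleftrightarrow>
     k + m \<le> card (Q \<inter> S) \<and> card (Q - D) \<le> k + m \<and> m \<le> card (Q \<inter> D - F) \<and>
     \<gamma> * k + m \<le> card (Q \<inter> D) \<and>
     (if s then k + m < card S \<and> card Q \<le> (\<gamma> + 1) * (k + m) + (\<gamma> - 1) \<and>
                (F \<subseteq> Q \<or> \<gamma> * k + m + (\<gamma> - 1) \<le> card (Q \<inter> D))
      else card Q \<le> (\<gamma> + 1) * (k + m))"

lemma card_Un_Int: "card ((Q \<union> P) \<inter> X) = card (Q \<inter> X) + card (P \<inter> X)"
  if "P \<inter> Q = {}" "finite P" "finite Q"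
  using that by (subst card_Un_disjoint[symmetric]) (auto intro!: arg_cong[of _ _ card])

text \<open>A predicted block lies in \<open>D\<close> and leaves \<open>k\<close> and
  \<open>m\<close> unchanged; the witness set after it completes the round and raises
  \<open>m\<close> if \<open>F\<close> is used up, otherwise \<open>k\<close>.\<close>

lemma budget_step:
  assumes un: "\<not> resolved G w Q" and QE: "Q \<subseteq> E" and nb: "next_batch \<gamma> G w s Q = (P, s')"
    and S: "S \<subseteq> E" "resolved G w S" and D: "D \<subseteq> E" "resolved G w D" "F \<subseteq> D"
    and b: "budget S D s Q k m"
  shows "\<exists>k m. budget S D s' (Q \<union> P) k m"
proof (cases rule: next_batch_cases[OF un, of s, case_names predicted witness])
  case (predicted P')
  have P': "P' = P" and s': "s' = True" using predicted(1) nb by simp_all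
  note predicted = predicted[unfolded P']
  have fin: "finite Q" "finite P" "finite S"
    using QE S(1) predicted(4) predicted_optimum(1) finite_edges
    by (meson Diff_subset finite_subset)+
  have PF: "P \<subseteq> F" "P \<inter> Q = {}" using predicted(4) by auto
  have add: "card ((Q \<union> P) \<inter> X) = card (Q \<inter> X) + card (P \<inter> X)" for X
    by (rule card_Un_Int[OF PF(2) fin(2,1)])
  \<comment> \<open>An infeasible \<open>Q\<close> misses an edge of \<open>S\<close>, which leaves
    one unit of \<open>S\<close> in reserve for the round in progress.\<close>
  have "\<not> S \<subseteq> Q" using un resolved_mono[OF mgraph w_interval _ S(2)] by blast
  then have lt: "card (Q \<inter> S) < card S" using fin by (intro psubset_card_mono) auto
  have D': "(Q \<union> P) - D = Q - D" "(Q \<union> P) \<inter> D - F = Q \<inter> D - F" "P \<inter> D = P"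
    using PF D by auto
  have QP: "card (Q \<union> P) = card Q + card P" by (rule card_Un_disjoint) (use fin PF in auto)
  have block: "F \<subseteq> Q \<union> P \<or> card P = \<gamma> - 1"
  proof (cases "card P = \<gamma> - 1")
    case False
    then have "card P = card (F - Q)" using predicted(5) by (auto simp: min_def split: if_splits)
    moreover have "finite (F - Q)" using predicted_optimum(1) finite_edges finite_subset by blast
    ultimately have "P = F - Q" using predicted(4) card_subset_eq[of "F - Q" P] by simp
    then show ?thesis by blast
  qed simp
  have le: "card P \<le> \<gamma> - 1" using predicted(5) by simp
  have b': "k + m \<le> card (Q \<inter> S)" "card (Q - D) \<le> k + m" "m \<le> card (Q \<inter> D - F)"
    "\<gamma> * k + m \<le> card (Q \<inter> D)" "card Q \<le> (\<gamma> + 1) * (k + m)"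
    using b predicted(2) by (simp_all add: budget_def)
  have "budget S D True (Q \<union> P) k m"
    unfolding budget_def if_True D'(1,2) add QP D'(3)
  proof (intro conjI)
    show "F \<subseteq> Q \<union> P \<or> \<gamma> * k + m + (\<gamma> - 1) \<le> card (Q \<inter> D) + card P"
      using block b'(4) by linarith
  qed (use b' le lt in linarith)+
  then show ?thesis unfolding s' by blast
next
  case (witness W)
  have W: "W = P" and s': "s' = False" using witness(1) nb by simp_all
  note witness = witness[unfolded W]
  have P: "card P \<le> 2" "P \<subseteq> E - Q" using witness(3) by (auto simp: witness_set_def)
  have meet: "P \<inter> X \<noteq> {}" if "X \<subseteq> E" "resolved G w X" for X
    using witness(3) that w_interval unfolding witness_set_def by blast
  have fin: "finite Q" "finite P" using QE P(2) finite_edges by (meson Diff_subset finite_subset)+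
  have add: "card ((Q \<union> P) \<inter> X) = card (Q \<inter> X) + card (P \<inter> X)" for X
    by (rule card_Un_Int) (use P fin in auto)
  have "P \<inter> S \<noteq> {}" "P \<inter> D \<noteq> {}" using meet S D by blast+
  then have ge: "card (P \<inter> S) \<ge> 1" "card (P \<inter> D) \<ge> 1"
    using fin by (simp_all add: Suc_le_eq card_gt_0_iff)
  have "card P = card (P \<inter> D) + card (P - D)" using fin by (metis card_Int_Diff)
  then have PD: "card (P - D) \<le> 1" using ge P(1) by linarith
  have QD: "card (Q \<union> P - D) = card (Q - D) + card (P - D)"
    using add[of "- D"] by (simp add: Diff_eq)
  have QP: "card (Q \<union> P) = card Q + card P" by (rule card_Un_disjoint) (use fin P in auto)
  have b': "k + m \<le> card (Q \<inter> S)" "card (Q - D) \<le> k + m" "m \<le> card (Q \<inter> D - F)"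
    "\<gamma> * k + m \<le> card (Q \<inter> D)"
    using b by (simp_all add: budget_def)
  have "card Q \<le> (\<gamma> + 1) * (k + m) + (\<gamma> - 1)"
  proof (cases s)
    case False
    then have "card Q \<le> (\<gamma> + 1) * (k + m)" using b by (simp add: budget_def)
    then show ?thesis by linarith
  qed (use b in \<open>simp add: budget_def\<close>)
  then have total: "card Q + card P \<le> (\<gamma> + 1) * (k + m) + (\<gamma> + 1)" using P(1) gamma by linarith
  have distrib: "(\<gamma> + 1) * (x + 1) = (\<gamma> + 1) * x + (\<gamma> + 1)" for x by simp
  have "\<exists>k m. budget S D False (Q \<union> P) k m"
  proof (cases "F \<subseteq> Q")
    case True
    \<comment> \<open>With \<open>F\<close> exhausted, the edges of \<open>D\<close> in the witness
      set are new edges of \<open>D - F\<close>.\<close>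
    have "(Q \<union> P) \<inter> D - F = (Q \<union> P) \<inter> (D - F)" "Q \<inter> D - F = Q \<inter> (D - F)"
      "P \<inter> D = P \<inter> (D - F)" using True P by auto
    then have new: "card ((Q \<union> P) \<inter> D - F) = card (Q \<inter> D - F) + card (P \<inter> D)"
      using add[of "D - F"] by simp
    have "budget S D False (Q \<union> P) k (m + 1)"
      unfolding budget_def if_False new add QP QD add.assoc[symmetric, of k m 1] distrib
      using b' ge PD total by (intro conjI; linarith)
    then show ?thesis by blast
  next
    case False
    then have s using witness(2) by blast
    \<comment> \<open>\<open>F\<close> is not exhausted, so the block was full: it supplies
      \<open>\<gamma> - 1\<close> edges of \<open>D\<close>, and the witness set at least one
      more.\<close>
    then have full: "\<gamma> * k + m + (\<gamma> - 1) \<le> card (Q \<inter> D)" using b False by (simp add: budget_def)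
    have mono: "card (Q \<inter> D - F) \<le> card ((Q \<union> P) \<inter> D - F)"
      using fin by (intro card_mono) auto
    have eq: "k + 1 + m = k + m + 1" "\<gamma> * (k + 1) = \<gamma> * k + \<gamma>" by simp_all
    have "budget S D False (Q \<union> P) (k + 1) m"
      unfolding budget_def if_False add QP QD eq distrib
      using b' ge PD total full mono gamma by (intro conjI; linarith)
    then show ?thesis by blast
  qed
  then show ?thesis unfolding s' by blast
qed

section \<open>Runs of the algorithm: invariant and termination\<close>

lemma next_batch_fresh:
  assumes "\<not> resolved G w Q" "next_batch \<gamma> G w s Q = (P, s')"
  shows "P \<subseteq> E - Q" "P \<noteq> {}" "finite P"
proof -
  have "P \<subseteq> E - Q \<and> P \<noteq> {}"
  proof (cases rule: next_batch_cases[OF assms(1), of s, case_names predicted witness])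
    case (predicted P')
    then have "P' = P" using assms(2) by simp
    then show ?thesis using predicted(3,4) predicted_optimum(1) by blast
  next
    case (witness W)
    then have "W = P" using assms(2) by simp
    then show ?thesis using witness(3) unfolding witness_set_def by blast
  qed
  then show "P \<subseteq> E - Q" "P \<noteq> {}" by blast+
  then show "finite P" using finite_edges finite_subset by blast
qed

lemma batch_run_step_set: "fst ` set (h @ map (\<lambda>e. (e, w e)) b) = fst ` set h \<union> set b"
  by (simp add: image_Un image_image)

lemma strategy_unresolved:
  assumes r: "batch_run (strategy \<gamma> G) False w s h" and un: "\<not> resolved G w (fst ` set h)"
  obtains xs s' where "strategy \<gamma> G s h = (xs, s')" "next_batch \<gamma> G w s (fst ` set h) = (set xs, s')"
    "set xs \<subseteq> E - fst ` set h" "xs \<noteq> []"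
proof -
  obtain P s' where nb: "next_batch \<gamma> G w s (fst ` set h) = (P, s')" by (rule prod.exhaust)
  obtain xs where xs: "strategy \<gamma> G s h = (xs, s')" "set xs = P"
    using strategy_next_batch[OF r nb next_batch_fresh(3)[OF un nb]] by blast
  show ?thesis
    by (rule that[OF xs(1)]) (use nb xs(2) next_batch_fresh[OF un nb] in auto)
qed

lemma strategy_resolved:
  assumes "batch_run (strategy \<gamma> G) False w s h" "resolved G w (fst ` set h)"
  shows "fst (strategy \<gamma> G s h) = []"
proof -
  have "next_batch \<gamma> G w s (fst ` set h) = ({}, s)" using assms(2) by (simp add: next_batch_def)
  from strategy_next_batch[OF assms(1) this] obtain xs
    where "strategy \<gamma> G s h = (xs, s)" "set xs = {}" by blast
  then show ?thesis by simp
qed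

lemma batch_run_budget:
  assumes "batch_run (strategy \<gamma> G) False w s h"
    and S: "S \<subseteq> E" "resolved G w S" and D: "D \<subseteq> E" "resolved G w D" "F \<subseteq> D"
  shows "fst ` set h \<subseteq> E \<and> (\<exists>k m. budget S D s (fst ` set h) k m)"
  using assms(1)
proof induction
  case start
  have "budget S D False {} 0 0" by (simp add: budget_def)
  then show ?case by auto
next
  case (step s h b s')
  let ?Q = "fst ` set h"
  obtain k m where QE: "?Q \<subseteq> E" and bud: "budget S D s ?Q k m" using step.IH by blast
  have un: "\<not> resolved G w ?Q" using strategy_resolved[OF step.hyps(1)] step.hyps(2,3) by auto
  obtain xs t where xs: "strategy \<gamma> G s h = (xs, t)" "next_batch \<gamma> G w s ?Q = (set xs, t)"
    "set xs \<subseteq> E - ?Q" by (rule strategy_unresolved[OF step.hyps(1) un])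
  have bt: "b = xs" "s' = t" using xs(1) step.hyps(2) by simp_all
  have "?Q \<union> set xs \<subseteq> E" using QE xs(3) by blast
  moreover have "\<exists>k m. budget S D t (?Q \<union> set xs) k m"
    by (rule budget_step[OF un QE xs(2) S D bud])
  ultimately show ?case unfolding batch_run_step_set bt by blast
qed

text \<open>Take a reachable state with fewest unqueried edges; a further nonempty batch of fresh
  edges would leave fewer.\<close>

lemma terminates: "\<exists>s h. batch_run (strategy \<gamma> G) False w s h \<and> resolved G w (fst ` set h)"
proof -
  let ?R = "batch_run (strategy \<gamma> G) False w"
  let ?P = "\<lambda>x. ?R (fst x) (snd x)"
  have "?P (False, [])" by (simp add: batch_run.start)
  from ex_has_least_nat[of ?P, OF this, of "\<lambda>x. card (E - fst ` set (snd x))"]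
  obtain x where x: "?P x" "\<And>y. ?P y \<Longrightarrow> card (E - fst ` set (snd x)) \<le> card (E - fst ` set (snd y))"
    by blast
  define s h where "s = fst x" and "h = snd x"
  have r: "?R s h" using x(1) by (simp add: s_def h_def)
  have min: "card (E - fst ` set h) \<le> card (E - fst ` set h')" if "?R s' h'" for s' h'
    using x(2)[of "(s', h')"] that by (simp add: h_def)
  let ?Q = "fst ` set h"
  have "resolved G w ?Q"
  proof (rule ccontr)
    assume un: "\<not> resolved G w ?Q"
    obtain xs t where xs: "strategy \<gamma> G s h = (xs, t)" "set xs \<subseteq> E - ?Q" "xs \<noteq> []"
      by (rule strategy_unresolved[OF r un])
    let ?h = "h @ map (\<lambda>e. (e, w e)) xs"
    have "batch_run (strategy \<gamma> G) False w t ?h" using batch_run.step[OF r xs(1,3)] .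
    then have "card (E - ?Q) \<le> card (E - fst ` set ?h)" by (rule min)
    moreover obtain x where "x \<in> set xs" using xs(3) by (cases xs) auto
    then have "E - fst ` set ?h \<subset> E - ?Q" unfolding batch_run_step_set using xs(2) by blast
    then have "card (E - fst ` set ?h) < card (E - ?Q)"
      using finite_edges by (intro psubset_card_mono) auto
    ultimately show False by simp
  qed
  then show ?thesis using r by blast
qed

text \<open>Adding the error set makes predicted and true feasibility agree. For \<open>F\<close>
  this gives the first claim; for \<open>S\<close> it yields a competitor of \<open>F\<close> under
  the predictions, so \<open>F\<close> exceeds \<open>S\<close> by at most the number of
  errors.\<close>

lemma predicted_optimum_hop_errors:
  assumes "S \<subseteq> E" "resolved G w S"
  shows "resolved G w (F \<union> hop_errors G w)"
    and "card (F \<union> hop_errors G w) \<le> card S + 2 * card (hop_errors G w)"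
proof -
  let ?B = "hop_errors G w"
  have BE: "?B \<subseteq> E" by (auto simp: hop_errors_def)
  have "resolved G (pred G) (F \<union> ?B)"
    by (rule resolved_mono[OF mgraph pred_interval _ predicted_optimum(2)]) auto
  then show "resolved G w (F \<union> ?B)"
    using resolved_pred_iff[of G w "F \<union> ?B"] BE predicted_optimum(1) by simp
  have "resolved G w (S \<union> ?B)" by (rule resolved_mono[OF mgraph w_interval _ assms(2)]) auto
  then have "resolved G (pred G) (S \<union> ?B)"
    using resolved_pred_iff[of G w "S \<union> ?B"] BE assms(1) by simp
  then have "card F \<le> card (S \<union> ?B)" by (intro predicted_optimum(3)) (use BE assms(1) in auto)
  then show "card (F \<union> ?B) \<le> card S + 2 * card ?B"
    using card_Un_le[of F ?B] card_Un_le[of S ?B] by linarith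
qed

lemma competitive:
  assumes "batch_run (strategy \<gamma> G) False w s h" "S \<subseteq> E" "resolved G w S"
  shows "card (fst ` set h) \<le> (\<gamma> + 1) * card S"
    and "\<gamma> * card (fst ` set h) \<le> (\<gamma> + 1) * card S + 5 * \<gamma> * card (hop_errors G w)"
proof -
  let ?Q = "fst ` set h" and ?B = "hop_errors G w"
  define D where "D = F \<union> ?B"
  have BE: "?B \<subseteq> E" by (auto simp: hop_errors_def)
  have D: "D \<subseteq> E" "resolved G w D" "F \<subseteq> D" "card D \<le> card S + 2 * card ?B"
    using predicted_optimum(1) predicted_optimum_hop_errors[OF assms(2,3)] BE by (auto simp: D_def)
  then obtain k m where b: "budget S D s ?Q k m"
    using batch_run_budget[OF assms D(1-3)] by blast
  have fin: "finite S" "finite D" "finite ?B"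
    using assms(2) D BE finite_edges by (auto intro: finite_subset)
  have "k + m \<le> card S"
    using b card_mono[OF fin(1), of "?Q \<inter> S"] by (auto simp: budget_def)
  then have km: "(\<gamma> + 1) * (k + m) \<le> (\<gamma> + 1) * card S" by (intro mult_le_mono) auto
  show "card ?Q \<le> (\<gamma> + 1) * card S"
  proof (cases s)
    \<comment> \<open>The run stops right after a block: the reserve \<open>k + m < card S\<close>
      pays for its at most \<open>\<gamma> - 1\<close> queries.\<close>
    case True
    then have "k + m + 1 \<le> card S" "card ?Q \<le> (\<gamma> + 1) * (k + m) + (\<gamma> - 1)"
      using b by (auto simp: budget_def)
    moreover from this have "(\<gamma> + 1) * (k + m + 1) \<le> (\<gamma> + 1) * card S"
      by (intro mult_le_mono) auto
    ultimately show ?thesis by (simp add: algebra_simps)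
  next
    case False
    then show ?thesis using b km by (simp add: budget_def)
  qed
  have QD: "card (?Q \<inter> D) \<le> card D" using fin by (intro card_mono) auto
  have "card ?Q = card (?Q \<inter> D) + card (?Q - D)" by (metis List.finite_set card_Int_Diff finite_imageI)
  then have "card ?Q \<le> card D + k + m" using b QD by (auto simp: budget_def)
  \<comment> \<open>Here \<open>\<gamma> * (k + m) = (\<gamma> * k + m) + (\<gamma> - 1) * m\<close>
    is at most \<open>card D + (\<gamma> - 1) * card ?B\<close>. As
    \<open>card D \<le> card S + 2 * card ?B\<close>, the errors count \<open>2 * (\<gamma> + 1) +
    \<gamma> - 1 = 3 * \<gamma> + 1 \<le> 5 * \<gamma>\<close> times.\<close>
  then have "\<gamma> * card ?Q \<le> \<gamma> * (card D + k + m)" by (intro mult_le_mono) auto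
  moreover have "\<gamma> * k + m \<le> card D" using b QD by (auto simp: budget_def)
  moreover have "m \<le> card ?B"
  proof -
    have "card (?Q \<inter> D - F) \<le> card ?B" using fin by (intro card_mono) (auto simp: D_def)
    then show ?thesis using b by (auto simp: budget_def)
  qed
  then have "(\<gamma> - 1) * m \<le> (\<gamma> - 1) * card ?B" by (intro mult_le_mono) auto
  moreover have "(\<gamma> - 1) * x + x = \<gamma> * x" for x using gamma by (cases \<gamma>) auto
  note this[of m] this[of "card ?B"]
  moreover have "(\<gamma> + 1) * card D \<le> (\<gamma> + 1) * (card S + 2 * card ?B)"
    using D(4) by (intro mult_le_mono) auto
  moreover have "2 * card ?B \<le> \<gamma> * card ?B" using gamma by (intro mult_le_mono) auto
  ultimately show "\<gamma> * card ?Q \<le> (\<gamma> + 1) * card S + 5 * \<gamma> * card ?B"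
    by (simp add: algebra_simps)
qed

end

theorem theorem5p2:
  fixes \<gamma> :: nat
  assumes "\<gamma> \<ge> 2"
  shows "\<exists>A :: ('v, 'e) algorithm. \<forall>G w. mst_instance G w \<longrightarrow>
    (\<exists>ALG. queries A G w ALG \<and> feasible G w ALG \<and>
      (\<forall>OPT. optimal G w OPT \<longrightarrow>
        real (card ALG) \<le>
          min (1 + 1 / real \<gamma> + 5 * real (hop_distance G w) / real (card OPT)) (real \<gamma> + 1)
            * real (card OPT)))"
proof (rule exI[of _ "\<lambda>G h. batch_algorithm (strategy \<gamma> G) False [] h"], intro allI impI)
  fix G :: "('v, 'e) mst_input" and w
  assume inst: "mst_instance G w"
  interpret query_instance G w \<gamma> using inst assms by unfold_locales
  obtain s h where r: "batch_run (strategy \<gamma> G) False w s h" and res: "resolved G w (fst ` set h)"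
    using terminates by blast
  let ?Q = "fst ` set h"
  have "fst (strategy \<gamma> G s h) = []" using r res by (rule strategy_resolved)
  then have "queries (\<lambda>G h. batch_algorithm (strategy \<gamma> G) False [] h) G w ?Q"
    by (rule queries_batch_run[of "strategy \<gamma>" G, OF r])
  moreover have "feasible G w ?Q"
    using feasible_iff_resolved[OF inst, of ?Q] res
      batch_run_budget[OF r subset_refl resolved_edges subset_refl resolved_edges predicted_optimum(1)]
    by blast
  moreover have "real (card ?Q) \<le>
      min (1 + 1 / real \<gamma> + 5 * real (hop_distance G w) / real (card OPT)) (real \<gamma> + 1)
        * real (card OPT)" if "optimal G w OPT" for OPT
  proof -
    have OPT: "OPT \<subseteq> E" "resolved G w OPT"
      using that feasible_iff_resolved[OF inst, of OPT] by (auto simp: optimal_def feasible_def)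
    let ?k = "real (hop_distance G w)" and ?o = "real (card OPT)"
    have "card ?Q \<le> (\<gamma> + 1) * card OPT" using competitive(1)[OF r OPT] .
    then have rob: "real (card ?Q) \<le> (real \<gamma> + 1) * ?o"
      by (metis of_nat_1 of_nat_add of_nat_le_iff of_nat_mult)
    have "real (\<gamma> * card ?Q) \<le> real ((\<gamma> + 1) * card OPT + 5 * \<gamma> * card (hop_errors G w))"
      using competitive(2)[OF r OPT] by (rule of_nat_mono)
    also have "\<dots> \<le> real ((\<gamma> + 1) * card OPT + 5 * \<gamma> * hop_distance G w)"
      using card_hop_errors[OF finite_edges, of w] by (intro of_nat_mono add_mono mult_le_mono) auto
    finally have "real \<gamma> * real (card ?Q) \<le> (real \<gamma> + 1) * ?o + 5 * real \<gamma> * ?k"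
      by (simp add: algebra_simps)
    then have con: "real (card ?Q) \<le> (1 + 1 / real \<gamma>) * ?o + 5 * ?k"
      using assms by (simp add: field_simps)
    show ?thesis
    proof (cases "card OPT = 0")
      \<comment> \<open>The right-hand side is 0 whatever the quotient means, and \<open>rob\<close>
        then gives \<open>card ?Q = 0\<close>.\<close>
      case True
      then show ?thesis using rob by simp
    next
      case False
      then have "(1 + 1 / real \<gamma>) * ?o + 5 * ?k = (1 + 1 / real \<gamma> + 5 * ?k / ?o) * ?o"
        by (simp add: field_simps)
      then show ?thesis using rob con by (simp add: min_def)
    qed
  qed
  ultimately show "\<exists>ALG. queries (\<lambda>G h. batch_algorithm (strategy \<gamma> G) False [] h) G w ALG \<and>
    feasible G w ALG \<and> (\<forall>OPT. optimal G w OPT \<longrightarrow> real (card ALG) \<le>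
      min (1 + 1 / real \<gamma> + 5 * real (hop_distance G w) / real (card OPT)) (real \<gamma> + 1)
        * real (card OPT))" by blast
qed

end
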